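(* Let $\Gamma$ be a groupoid and let $R$ be a $\Gamma$-graded ring that is both left and right $\Gamma_0$-artinian. The following assertions hold: (1) $R$ is gr-semiprimary. (2) $R$ is both a left and a right $\Gamma_0$-noetherian ring.
   Context: A groupoid $\Gamma$ is the set of morphisms of a small category in which all morphisms are invertible; $\Gamma_0\subseteq\Gamma$ is the set of identity morphisms; $d(\gamma)=\gamma^{-1}\gamma$, $r(\gamma)=\gamma\gamma^{-1}$; the product $\gamma\delta$ is defined iff $d(\gamma)=r(\delta)$. Rings are associative, not necessarily unital. A $\Gamma$-graded ring is a ring $R=\bigoplus_{\gamma\in\Gamma}R_\gamma$ (additive subgroups) with $R_\gamma R_\delta\subseteq R_{\gamma\delta}$ if $d(\gamma)=r(\delta)$ and $R_\gamma R_\delta=0$ otherwise; it is always assumed object unital: for each $e\in\Gamma_0$ the ring $R_e$ has an identity $1_e$ (possibly $0$) with $1_{r(\gamma)}a=a=a1_{d(\gamma)}$ for all $a\in R_\gamma$, $\gamma\in\Gamma$. A one- or two-sided ideal $U$ of $R$ is graded if $U=\bigoplus_\gamma (U\cap R_\gamma)$. $R$ is right (resp. left) $\Gamma_0$-artinian if, for every $e\in\Gamma_0$, there is no infinite strictly decreasing chain of graded right ideals of $R$ contained in $1_eR$ (resp. graded left ideals contained in $R1_e$). Right (left) $\Gamma_0$-noetherian is defined in the same way with increasing chains. $\mathrm{rad}^{\mathrm{gr}}(R)$, the graded Jacobson radical, is the intersection of all gr-maximal graded right ideals (those maximal among proper graded right ideals); it is a graded two-sided ideal. A nonzero graded right ideal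 is gr-simple if it contains no graded right ideals other than $0$ and itself; a $\Gamma$-graded ring is gr-semisimple if it is a sum of gr-simple graded right ideals. A graded ideal $U$ is objectwise nilpotent if for each $e\in\Gamma_0$ there are positive integers $n_e,m_e$ with $1_eU^{n_e}=0$ and $U^{m_e}1_e=0$. $R$ is gr-semiprimary if the $\Gamma$-graded ring $R/\mathrm{rad}^{\mathrm{gr}}(R)$ is gr-semisimple and $\mathrm{rad}^{\mathrm{gr}}(R)$ is objectwise nilpotent. *)

theory Defs
  imports "HOL-Algebra.QuotRing" "HOL-Algebra.Ideal_Product"
begin

section \<open>Groupoids\<close>

text \<open>
  A small category is given by its set of morphisms, with the objects identified with the
  identity morphisms; \<open>gdom\<close> and \<open>gran\<close> return identity morphisms, and
  \<open>gamma \<star> delta\<close> is meaningful only if \<open>gdom gamma = gran delta\<close>.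
\<close>

record 'g groupoid = "'g partial_object" +
  gcomp :: "'g \<Rightarrow> 'g \<Rightarrow> 'g" (infixl \<open>\<star>\<index>\<close> 70)
  gdom :: "'g \<Rightarrow> 'g"
  gran :: "'g \<Rightarrow> 'g"

locale groupoid =
  fixes \<Gamma> :: "('g, 'm) groupoid_scheme" (structure)
  assumes gdom_closed: "\<gamma> \<in> carrier \<Gamma> \<Longrightarrow> gdom \<Gamma> \<gamma> \<in> carrier \<Gamma>"
    and gran_closed: "\<gamma> \<in> carrier \<Gamma> \<Longrightarrow> gran \<Gamma> \<gamma> \<in> carrier \<Gamma>"
    and gdom_gdom: "\<gamma> \<in> carrier \<Gamma> \<Longrightarrow> gdom \<Gamma> (gdom \<Gamma> \<gamma>) = gdom \<Gamma> \<gamma>"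
    and gran_gdom: "\<gamma> \<in> carrier \<Gamma> \<Longrightarrow> gran \<Gamma> (gdom \<Gamma> \<gamma>) = gdom \<Gamma> \<gamma>"
    and gdom_gran: "\<gamma> \<in> carrier \<Gamma> \<Longrightarrow> gdom \<Gamma> (gran \<Gamma> \<gamma>) = gran \<Gamma> \<gamma>"
    and gran_gran: "\<gamma> \<in> carrier \<Gamma> \<Longrightarrow> gran \<Gamma> (gran \<Gamma> \<gamma>) = gran \<Gamma> \<gamma>"
    and gcomp_closed:
      "\<lbrakk>\<gamma> \<in> carrier \<Gamma>; \<delta> \<in> carrier \<Gamma>; gdom \<Gamma> \<gamma> = gran \<Gamma> \<delta>\<rbrakk> \<Longrightarrow> \<gamma> \<star> \<delta> \<in> carrier \<Gamma>"
    and gdom_gcomp: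
      "\<lbrakk>\<gamma> \<in> carrier \<Gamma>; \<delta> \<in> carrier \<Gamma>; gdom \<Gamma> \<gamma> = gran \<Gamma> \<delta>\<rbrakk> \<Longrightarrow> gdom \<Gamma> (\<gamma> \<star> \<delta>) = gdom \<Gamma> \<delta>"
    and gran_gcomp:
      "\<lbrakk>\<gamma> \<in> carrier \<Gamma>; \<delta> \<in> carrier \<Gamma>; gdom \<Gamma> \<gamma> = gran \<Gamma> \<delta>\<rbrakk> \<Longrightarrow> gran \<Gamma> (\<gamma> \<star> \<delta>) = gran \<Gamma> \<gamma>"
    and gcomp_assoc:
      "\<lbrakk>\<gamma> \<in> carrier \<Gamma>; \<delta> \<in> carrier \<Gamma>; \<epsilon> \<in> carrier \<Gamma>; gdom \<Gamma> \<gamma> = gran \<Gamma> \<delta>; gdom \<Gamma> \<delta> = gran \<Gamma> \<epsilon>\<rbrakk>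
        \<Longrightarrow> \<gamma> \<star> \<delta> \<star> \<epsilon> = \<gamma> \<star> (\<delta> \<star> \<epsilon>)"
    and gcomp_gdom: "\<gamma> \<in> carrier \<Gamma> \<Longrightarrow> \<gamma> \<star> gdom \<Gamma> \<gamma> = \<gamma>"
    and gran_gcomp_self: "\<gamma> \<in> carrier \<Gamma> \<Longrightarrow> gran \<Gamma> \<gamma> \<star> \<gamma> = \<gamma>"
    and invertible:
      "\<gamma> \<in> carrier \<Gamma> \<Longrightarrow> \<exists>\<delta> \<in> carrier \<Gamma>. gdom \<Gamma> \<delta> = gran \<Gamma> \<gamma> \<and> gran \<Gamma> \<delta> = gdom \<Gamma> \<gamma> \<and>
         \<delta> \<star> \<gamma> = gdom \<Gamma> \<gamma> \<and> \<gamma> \<star> \<delta> = gran \<Gamma> \<gamma>"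

definition identities :: "('g, 'm) groupoid_scheme \<Rightarrow> 'g set"
  where "identities \<Gamma> = gdom \<Gamma> ` carrier \<Gamma>"

lemma (in groupoid) identities_eq_gran: "identities \<Gamma> = gran \<Gamma> ` carrier \<Gamma>"
  unfolding identities_def
  by (auto simp: image_iff) (metis gdom_closed gran_gdom, metis gran_closed gdom_gran)

section \<open>Rings that need not be unital\<close>

text \<open>
  We reuse the ring record, ignoring its \<open>one\<close> field; this makes \<open>additive_subgroup\<close>,
  \<open>finsum\<close>, \<open>ideal_prod\<close> and \<open>Quot\<close> available.
\<close>

locale nonunital_ring = abelian_group R for R (structure) +
  assumes mult_closed: "\<lbrakk>x \<in> carrier R; y \<in> carrier R\<rbrakk> \<Longrightarrow> x \<otimes> y \<in> carrier R"
    and mult_assoc: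
      "\<lbrakk>x \<in> carrier R; y \<in> carrier R; z \<in> carrier R\<rbrakk> \<Longrightarrow> x \<otimes> y \<otimes> z = x \<otimes> (y \<otimes> z)"
    and left_distrib:
      "\<lbrakk>x \<in> carrier R; y \<in> carrier R; z \<in> carrier R\<rbrakk> \<Longrightarrow> (x \<oplus> y) \<otimes> z = x \<otimes> z \<oplus> y \<otimes> z"
    and right_distrib:
      "\<lbrakk>x \<in> carrier R; y \<in> carrier R; z \<in> carrier R\<rbrakk> \<Longrightarrow> z \<otimes> (x \<oplus> y) = z \<otimes> x \<oplus> z \<otimes> y"

definition right_ideal :: "('a, 'b) ring_scheme \<Rightarrow> 'a set \<Rightarrow> bool"
  where "right_ideal R U \<longleftrightarrow>
    additive_subgroup U R \<and> (\<forall>u \<in> U. \<forall>a \<in> carrier R. u \<otimes>\<^bsub>R\<^esub> a \<in> U)"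

definition left_ideal :: "('a, 'b) ring_scheme \<Rightarrow> 'a set \<Rightarrow> bool"
  where "left_ideal R U \<longleftrightarrow>
    additive_subgroup U R \<and> (\<forall>u \<in> U. \<forall>a \<in> carrier R. a \<otimes>\<^bsub>R\<^esub> u \<in> U)"

text \<open>\<open>ideal_power R U n\<close> is the usual \<open>U\<^sup>n\<close> for positive \<open>n\<close> only; for \<open>n = 0\<close> it is \<open>U\<close>.\<close>

definition ideal_power :: "('a, 'b) ring_scheme \<Rightarrow> 'a set \<Rightarrow> nat \<Rightarrow> 'a set"
  where "ideal_power R U n = ((\<lambda>V. ideal_prod R V U) ^^ (n - 1)) U"

definition family_sum :: "('a, 'b) ring_scheme \<Rightarrow> 'i set \<Rightarrow> ('i \<Rightarrow> 'a set) \<Rightarrow> 'a set"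
  where "family_sum R I A = {finsum R f F | f F. finite F \<and> F \<subseteq> I \<and> f \<in> (\<Pi> i\<in>F. A i)}"

definition is_direct_sum ::
    "('a, 'b) ring_scheme \<Rightarrow> 'a set \<Rightarrow> 'i set \<Rightarrow> ('i \<Rightarrow> 'a set) \<Rightarrow> bool"
  where "is_direct_sum R U I A \<longleftrightarrow>
    (\<forall>i \<in> I. additive_subgroup (A i) R) \<and> U = family_sum R I A \<and>
    (\<forall>F f. finite F \<and> F \<subseteq> I \<and> f \<in> (\<Pi> i\<in>F. A i) \<and> finsum R f F = \<zero>\<^bsub>R\<^esub>
      \<longrightarrow> (\<forall>i \<in> F. f i = \<zero>\<^bsub>R\<^esub>))"

section \<open>Graded rings\<close>

text \<open>
  A grading is a function \<open>S\<close> with \<open>S gamma\<close> the homogeneous component of degree \<open>gamma\<close>; its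
  values outside \<open>carrier \<Gamma>\<close> are irrelevant.
\<close>

definition is_local_unit :: "('a, 'b) ring_scheme \<Rightarrow> ('g \<Rightarrow> 'a set) \<Rightarrow> 'g \<Rightarrow> 'a \<Rightarrow> bool"
  where "is_local_unit R S e u \<longleftrightarrow>
    u \<in> S e \<and> (\<forall>a \<in> S e. u \<otimes>\<^bsub>R\<^esub> a = a \<and> a \<otimes>\<^bsub>R\<^esub> u = a)"

definition local_unit :: "('a, 'b) ring_scheme \<Rightarrow> ('g \<Rightarrow> 'a set) \<Rightarrow> 'g \<Rightarrow> 'a"
  where "local_unit R S e = (THE u. is_local_unit R S e u)"

lemma is_local_unit_unique:
  "is_local_unit R S e u \<Longrightarrow> is_local_unit R S e v \<Longrightarrow> u = v"
  unfolding is_local_unit_def by metis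

lemma local_unit_eq: "is_local_unit R S e u \<Longrightarrow> local_unit R S e = u"
  unfolding local_unit_def by (rule the_equality) (auto intro: is_local_unit_unique)

locale graded_ring = groupoid \<Gamma> + nonunital_ring R
  for \<Gamma> :: "('g, 'm) groupoid_scheme" and R :: "('a, 'b) ring_scheme" and S :: "'g \<Rightarrow> 'a set" +
  assumes direct_sum: "is_direct_sum R (carrier R) (carrier \<Gamma>) S"
    and mult_homogeneous:
      "\<lbrakk>\<gamma> \<in> carrier \<Gamma>; \<delta> \<in> carrier \<Gamma>; gdom \<Gamma> \<gamma> = gran \<Gamma> \<delta>; a \<in> S \<gamma>; b \<in> S \<delta>\<rbrakk>
        \<Longrightarrow> a \<otimes>\<^bsub>R\<^esub> b \<in> S (\<gamma> \<star>\<^bsub>\<Gamma>\<^esub> \<delta>)"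
    and mult_homogeneous_zero:
      "\<lbrakk>\<gamma> \<in> carrier \<Gamma>; \<delta> \<in> carrier \<Gamma>; gdom \<Gamma> \<gamma> \<noteq> gran \<Gamma> \<delta>; a \<in> S \<gamma>; b \<in> S \<delta>\<rbrakk>
        \<Longrightarrow> a \<otimes>\<^bsub>R\<^esub> b = \<zero>\<^bsub>R\<^esub>"
    and ex_local_unit: "e \<in> identities \<Gamma> \<Longrightarrow> \<exists>u. is_local_unit R S e u"
    and local_unit_left:
      "\<lbrakk>\<gamma> \<in> carrier \<Gamma>; a \<in> S \<gamma>\<rbrakk> \<Longrightarrow> local_unit R S (gran \<Gamma> \<gamma>) \<otimes>\<^bsub>R\<^esub> a = a"
    and local_unit_right:
      "\<lbrakk>\<gamma> \<in> carrier \<Gamma>; a \<in> S \<gamma>\<rbrakk> \<Longrightarrow> a \<otimes>\<^bsub>R\<^esub> local_unit R S (gdom \<Gamma> \<gamma>) = a"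

definition is_graded ::
    "('g, 'm) groupoid_scheme \<Rightarrow> ('a, 'b) ring_scheme \<Rightarrow> ('g \<Rightarrow> 'a set) \<Rightarrow> 'a set \<Rightarrow> bool"
  where "is_graded \<Gamma> R S U \<longleftrightarrow> is_direct_sum R U (carrier \<Gamma>) (\<lambda>\<gamma>. U \<inter> S \<gamma>)"

definition graded_right_ideal ::
    "('g, 'm) groupoid_scheme \<Rightarrow> ('a, 'b) ring_scheme \<Rightarrow> ('g \<Rightarrow> 'a set) \<Rightarrow> 'a set \<Rightarrow> bool"
  where "graded_right_ideal \<Gamma> R S U \<longleftrightarrow> right_ideal R U \<and> is_graded \<Gamma> R S U"

definition graded_left_ideal ::
    "('g, 'm) groupoid_scheme \<Rightarrow> ('a, 'b) ring_scheme \<Rightarrow> ('g \<Rightarrow> 'a set) \<Rightarrow> 'a set \<Rightarrow> bool"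
  where "graded_left_ideal \<Gamma> R S U \<longleftrightarrow> left_ideal R U \<and> is_graded \<Gamma> R S U"

section \<open>Chain conditions\<close>

definition right_\<Gamma>0_artinian ::
    "('g, 'm) groupoid_scheme \<Rightarrow> ('a, 'b) ring_scheme \<Rightarrow> ('g \<Rightarrow> 'a set) \<Rightarrow> bool"
  where "right_\<Gamma>0_artinian \<Gamma> R S \<longleftrightarrow> (\<forall>e \<in> identities \<Gamma>.
    \<not> (\<exists>U :: nat \<Rightarrow> 'a set. \<forall>n. graded_right_ideal \<Gamma> R S (U n) \<and>
         U n \<subseteq> local_unit R S e <#\<^bsub>R\<^esub> carrier R \<and> U (Suc n) \<subset> U n))"

definition left_\<Gamma>0_artinian ::
    "('g, 'm) groupoid_scheme \<Rightarrow> ('a, 'b) ring_scheme \<Rightarrow> ('g \<Rightarrow> 'a set) \<Rightarrow> bool"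
  where "left_\<Gamma>0_artinian \<Gamma> R S \<longleftrightarrow> (\<forall>e \<in> identities \<Gamma>.
    \<not> (\<exists>U :: nat \<Rightarrow> 'a set. \<forall>n. graded_left_ideal \<Gamma> R S (U n) \<and>
         U n \<subseteq> carrier R #>\<^bsub>R\<^esub> local_unit R S e \<and> U (Suc n) \<subset> U n))"

definition right_\<Gamma>0_noetherian ::
    "('g, 'm) groupoid_scheme \<Rightarrow> ('a, 'b) ring_scheme \<Rightarrow> ('g \<Rightarrow> 'a set) \<Rightarrow> bool"
  where "right_\<Gamma>0_noetherian \<Gamma> R S \<longleftrightarrow> (\<forall>e \<in> identities \<Gamma>.
    \<not> (\<exists>U :: nat \<Rightarrow> 'a set. \<forall>n. graded_right_ideal \<Gamma> R S (U n) \<and>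
         U n \<subseteq> local_unit R S e <#\<^bsub>R\<^esub> carrier R \<and> U n \<subset> U (Suc n)))"

definition left_\<Gamma>0_noetherian ::
    "('g, 'm) groupoid_scheme \<Rightarrow> ('a, 'b) ring_scheme \<Rightarrow> ('g \<Rightarrow> 'a set) \<Rightarrow> bool"
  where "left_\<Gamma>0_noetherian \<Gamma> R S \<longleftrightarrow> (\<forall>e \<in> identities \<Gamma>.
    \<not> (\<exists>U :: nat \<Rightarrow> 'a set. \<forall>n. graded_left_ideal \<Gamma> R S (U n) \<and>
         U n \<subseteq> carrier R #>\<^bsub>R\<^esub> local_unit R S e \<and> U n \<subset> U (Suc n)))"

section \<open>Radical, semisimple and semiprimary graded rings\<close>

definition gr_maximal ::
    "('g, 'm) groupoid_scheme \<Rightarrow> ('a, 'b) ring_scheme \<Rightarrow> ('g \<Rightarrow> 'a set) \<Rightarrow> 'a set \<Rightarrow> bool"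
  where "gr_maximal \<Gamma> R S M \<longleftrightarrow> graded_right_ideal \<Gamma> R S M \<and> M \<noteq> carrier R \<and>
    (\<forall>N. graded_right_ideal \<Gamma> R S N \<and> M \<subseteq> N \<longrightarrow> N = M \<or> N = carrier R)"

text \<open>If there are no gr-maximal right ideals, the intersection is all of \<open>R\<close>.\<close>

definition gr_radical ::
    "('g, 'm) groupoid_scheme \<Rightarrow> ('a, 'b) ring_scheme \<Rightarrow> ('g \<Rightarrow> 'a set) \<Rightarrow> 'a set"
  where "gr_radical \<Gamma> R S = {a \<in> carrier R. \<forall>M. gr_maximal \<Gamma> R S M \<longrightarrow> a \<in> M}"

definition gr_simple ::
    "('g, 'm) groupoid_scheme \<Rightarrow> ('a, 'b) ring_scheme \<Rightarrow> ('g \<Rightarrow> 'a set) \<Rightarrow> 'a set \<Rightarrow> bool"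
  where "gr_simple \<Gamma> R S V \<longleftrightarrow> graded_right_ideal \<Gamma> R S V \<and> V \<noteq> {\<zero>\<^bsub>R\<^esub>} \<and>
    (\<forall>W. graded_right_ideal \<Gamma> R S W \<and> W \<subseteq> V \<longrightarrow> W = {\<zero>\<^bsub>R\<^esub>} \<or> W = V)"

definition gr_semisimple ::
    "('g, 'm) groupoid_scheme \<Rightarrow> ('a, 'b) ring_scheme \<Rightarrow> ('g \<Rightarrow> 'a set) \<Rightarrow> bool"
  where "gr_semisimple \<Gamma> R S \<longleftrightarrow>
    (\<exists>\<V>. (\<forall>V \<in> \<V>. gr_simple \<Gamma> R S V) \<and> carrier R = family_sum R \<V> (\<lambda>V. V))"

definition objectwise_nilpotent ::
    "('g, 'm) groupoid_scheme \<Rightarrow> ('a, 'b) ring_scheme \<Rightarrow> ('g \<Rightarrow> 'a set) \<Rightarrow> 'a set \<Rightarrow> bool"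
  where "objectwise_nilpotent \<Gamma> R S U \<longleftrightarrow> (\<forall>e \<in> identities \<Gamma>. \<exists>n > 0. \<exists>m > 0.
    local_unit R S e <#\<^bsub>R\<^esub> ideal_power R U n = {\<zero>\<^bsub>R\<^esub>} \<and>
    ideal_power R U m #>\<^bsub>R\<^esub> local_unit R S e = {\<zero>\<^bsub>R\<^esub>})"

text \<open>The grading \<open>(R/J)\<^sub>\<gamma> = (R\<^sub>\<gamma> + J)/J\<close> induced on \<open>R Quot J\<close>.\<close>

definition quotient_grading ::
    "('a, 'b) ring_scheme \<Rightarrow> ('g \<Rightarrow> 'a set) \<Rightarrow> 'a set \<Rightarrow> 'g \<Rightarrow> 'a set set"
  where "quotient_grading R S J \<gamma> = (\<lambda>a. J +>\<^bsub>R\<^esub> a) ` S \<gamma>"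

text \<open>In particular, \<open>Quot\<close> works as intended although \<open>R\<close> need not be unital.\<close>

lemma (in graded_ring) quotient_graded_ring:
  assumes JR: "graded_right_ideal \<Gamma> R S J" and JL: "graded_left_ideal \<Gamma> R S J"
  shows "graded_ring \<Gamma> (R Quot J) (quotient_grading R S J)"
proof -
  have Jadd: "additive_subgroup J R"
    and Jr: "\<And>u a. u \<in> J \<Longrightarrow> a \<in> carrier R \<Longrightarrow> u \<otimes>\<^bsub>R\<^esub> a \<in> J"
    and Jl: "\<And>u a. u \<in> J \<Longrightarrow> a \<in> carrier R \<Longrightarrow> a \<otimes>\<^bsub>R\<^esub> u \<in> J"
    and Jgr: "J = family_sum R (carrier \<Gamma>) (\<lambda>\<gamma>. J \<inter> S \<gamma>)"
    using JR JL
    by (auto simp: graded_right_ideal_def graded_left_ideal_def right_ideal_def left_ideal_def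
        is_graded_def is_direct_sum_def)
  have Jgr_mem: "x \<in> J \<longleftrightarrow> x \<in> family_sum R (carrier \<Gamma>) (\<lambda>\<gamma>. J \<inter> S \<gamma>)" for x
    using Jgr by (rule arg_cong)
  interpret J: abelian_subgroup J R
    using Jadd by (rule abelian_subgroupI3) (rule abelian_group_axioms)
  let ?Q = "R Quot J"
  define p where "p a = J +>\<^bsub>R\<^esub> a" for a
  note Jc = J.a_subset[THEN subsetD]
  have pmem: "x \<in> p a \<longleftrightarrow> (\<exists>h\<in>J. x = h \<oplus>\<^bsub>R\<^esub> a)" for x a
    by (auto simp: p_def a_r_coset_def r_coset_def)
  have p_eq: "p a = p b" if "a \<in> p b" "b \<in> carrier R" for a b
    using a_repr_independence[OF that(1)[unfolded p_def] that(2) J.a_subgroup] by (simp add: p_def)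
  have pJ: "p a = J \<longleftrightarrow> a \<in> J" if "a \<in> carrier R" for a
    unfolding p_def
    using a_coset_join1[OF _ that J.a_subgroup] a_coset_join2[OF that J.a_subgroup] by blast
  have Qc: "carrier ?Q = p ` carrier R"
    by (auto simp: FactRing_def A_RCOSETS_def RCOSETS_def p_def a_r_coset_def)
  have Q0: "\<zero>\<^bsub>?Q\<^esub> = J" by (simp add: FactRing_def)
  have Qadd: "p a \<oplus>\<^bsub>?Q\<^esub> p b = p (a \<oplus>\<^bsub>R\<^esub> b)" if "a \<in> carrier R" "b \<in> carrier R" for a b
    using that by (simp add: FactRing_def p_def J.a_rcos_sum)
  have Qmult: "p a \<otimes>\<^bsub>?Q\<^esub> p b = p (a \<otimes>\<^bsub>R\<^esub> b)" if ab: "a \<in> carrier R" "b \<in> carrier R" for a b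
  proof -
    have "p (x \<otimes>\<^bsub>R\<^esub> y) = p (a \<otimes>\<^bsub>R\<^esub> b)" if "x \<in> p a" "y \<in> p b" for x y
    proof -
      obtain h k where h: "h \<in> J" "x = h \<oplus>\<^bsub>R\<^esub> a" and k: "k \<in> J" "y = k \<oplus>\<^bsub>R\<^esub> b"
        using \<open>x \<in> p a\<close> \<open>y \<in> p b\<close> pmem by auto
      have "x \<otimes>\<^bsub>R\<^esub> y = (h \<otimes>\<^bsub>R\<^esub> (k \<oplus>\<^bsub>R\<^esub> b) \<oplus>\<^bsub>R\<^esub> a \<otimes>\<^bsub>R\<^esub> k) \<oplus>\<^bsub>R\<^esub> a \<otimes>\<^bsub>R\<^esub> b"
        using h k ab Jc by (simp add: left_distrib right_distrib mult_closed a_ac)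
      moreover have "h \<otimes>\<^bsub>R\<^esub> (k \<oplus>\<^bsub>R\<^esub> b) \<oplus>\<^bsub>R\<^esub> a \<otimes>\<^bsub>R\<^esub> k \<in> J"
        using h k ab Jc by (intro J.a_closed Jr Jl) auto
      ultimately have "x \<otimes>\<^bsub>R\<^esub> y \<in> p (a \<otimes>\<^bsub>R\<^esub> b)" unfolding pmem by blast
      then show ?thesis using ab by (intro p_eq) (auto simp: mult_closed)
    qed
    moreover have "a \<in> p a" "b \<in> p b" using ab J.a_rcos_self by (auto simp: p_def)
    moreover have "p a \<otimes>\<^bsub>?Q\<^esub> p b = (\<Union>x\<in>p a. \<Union>y\<in>p b. p (x \<otimes>\<^bsub>R\<^esub> y))"
      by (simp add: FactRing_def rcoset_mult_def p_def)
    ultimately show ?thesis by (metis (no_types, lifting) SUP_eq_const empty_iff)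
  qed
  have Qab: "abelian_group ?Q"
    by (rule comm_group_abelian_groupI)
      (simp add: FactRing_def J.a_factorgroup_is_comm_group[unfolded A_FactGroup_def'])
  have Qring: "nonunital_ring ?Q"
    by (intro nonunital_ring.intro nonunital_ring_axioms.intro Qab)
      (auto simp: Qc Qadd Qmult mult_closed mult_assoc left_distrib right_distrib)
  interpret Q: nonunital_ring ?Q by (rule Qring)
  have hom: "p \<in> hom (add_monoid R) (add_monoid ?Q)"
    by (auto simp: hom_def Qc Qadd)
  have ph: "group_hom (add_monoid R) (add_monoid ?Q) p"
    by (rule group_hom.intro[OF a_group Q.a_group group_hom_axioms.intro[OF hom]])
  have Ssub2: "additive_subgroup (S \<gamma>) R" if "\<gamma> \<in> carrier \<Gamma>" for \<gamma>
    using direct_sum that by (simp add: is_direct_sum_def)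
  note Ssub = additive_subgroup.a_subset[OF Ssub2] Ssub2
  have qg: "quotient_grading R S J \<gamma> = p ` S \<gamma>" for \<gamma>
    by (simp add: quotient_grading_def p_def)
  have psum: "p (finsum R f F) = finsum ?Q (\<lambda>i. p (f i)) F"
    if "finite F" "f \<in> F \<rightarrow> carrier R" for f :: "'g \<Rightarrow> 'a" and F
    using that
  proof (induction F)
    case empty
    show ?case using pJ[of "\<zero>\<^bsub>R\<^esub>"] by (simp add: Q0)
  next
    case (insert x F)
    then have "f \<in> F \<rightarrow> carrier R" "f x \<in> carrier R" by auto
    with insert show ?case
      by (simp add: Pi_def Qc Qadd[symmetric] finsum_closed)
  qed
  have ext: "finsum R (\<lambda>i. if i \<in> F then f i else \<zero>\<^bsub>R\<^esub>) (F \<union> F') = finsum R f F"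
    if "finite F" "finite F'" "f \<in> F \<rightarrow> carrier R" for f :: "'g \<Rightarrow> 'a" and F F'
    using that by (intro add.finprod_mono_neutral_cong_right) (auto simp: Pi_def)
  have ds: "is_direct_sum ?Q (carrier ?Q) (carrier \<Gamma>) (quotient_grading R S J)"
    unfolding is_direct_sum_def
  proof (intro conjI ballI allI impI)
    fix \<gamma> assume "\<gamma> \<in> carrier \<Gamma>"
    then show "additive_subgroup (quotient_grading R S J \<gamma>) ?Q"
      using Ssub(2)[of \<gamma>] group_hom.subgroup_img_is_subgroup[OF ph]
      by (auto simp: qg additive_subgroup_def)
  next
    show "carrier ?Q = family_sum ?Q (carrier \<Gamma>) (quotient_grading R S J)"
    proof (intro equalityI subsetI)
      fix X assume "X \<in> carrier ?Q"
      then obtain x where x: "x \<in> carrier R" "X = p x" by (auto simp: Qc)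
      then obtain f F where f: "finite F" "F \<subseteq> carrier \<Gamma>" "f \<in> (\<Pi> i\<in>F. S i)" "x = finsum R f F"
        using direct_sum unfolding is_direct_sum_def family_sum_def by auto
      then have "f \<in> F \<rightarrow> carrier R" using Ssub(1) by blast
      then have "X = finsum ?Q (\<lambda>i. p (f i)) F" using psum x f by auto
      then show "X \<in> family_sum ?Q (carrier \<Gamma>) (quotient_grading R S J)"
        using f unfolding family_sum_def qg by blast
    next
      fix X assume "X \<in> family_sum ?Q (carrier \<Gamma>) (quotient_grading R S J)"
      then obtain g F where "F \<subseteq> carrier \<Gamma>" "g \<in> (\<Pi> i\<in>F. p ` S i)" "X = finsum ?Q g F"
        unfolding family_sum_def qg by blast
      moreover from this have "g \<in> F \<rightarrow> carrier ?Q" using Ssub(1) unfolding Qc by fast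
      ultimately show "X \<in> carrier ?Q" using Q.finsum_closed by auto
    qed
  next
    fix F g i
    assume A: "finite F \<and> F \<subseteq> carrier \<Gamma> \<and> g \<in> Pi F (quotient_grading R S J) \<and>
      finsum ?Q g F = \<zero>\<^bsub>?Q\<^esub>" and i: "i \<in> F"
    then have F: "finite F" "F \<subseteq> carrier \<Gamma>" by auto
    have "\<forall>i\<in>F. \<exists>a. a \<in> S i \<and> g i = p a" using A by (auto simp: qg Pi_def)
    then obtain f where f: "\<And>i. i \<in> F \<Longrightarrow> f i \<in> S i" "\<And>i. i \<in> F \<Longrightarrow> g i = p (f i)" by metis
    have fc: "f \<in> F \<rightarrow> carrier R" using f(1) F Ssub(1) by blast
    have "finsum ?Q g F = finsum ?Q (\<lambda>i. p (f i)) F"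
      using f(2) fc Qc by (intro Q.finsum_cong') auto
    then have "p (finsum R f F) = J" using A psum[OF F(1) fc] Q0 by simp
    then have "finsum R f F \<in> J" using pJ finsum_closed[OF fc] by simp
    from this[THEN Jgr_mem[THEN iffD1]] obtain h F' where h: "finite F'" "F' \<subseteq> carrier \<Gamma>" "h \<in> (\<Pi> i\<in>F'. J \<inter> S i)"
      "finsum R f F = finsum R h F'"
      unfolding family_sum_def by blast
    have hc: "h \<in> F' \<rightarrow> carrier R" using h(3) Jc by (auto simp: Pi_def)
    define f' where "f' i = (if i \<in> F then f i else \<zero>\<^bsub>R\<^esub>)" for i
    define h' where "h' i = (if i \<in> F' then h i else \<zero>\<^bsub>R\<^esub>)" for i
    have f'c: "f' i \<in> carrier R" for i using fc by (auto simp: f'_def)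
    have h'c: "h' i \<in> carrier R" for i using hc by (auto simp: h'_def)
    have h'J: "h' i \<in> J" for i using h(3) by (auto simp: h'_def Pi_def)
    have S0: "\<zero>\<^bsub>R\<^esub> \<in> S i" if "i \<in> carrier \<Gamma>" for i
      using Ssub(2)[OF that] additive_subgroup.zero_closed by blast
    have f'S: "f' i \<in> S i" if "i \<in> F \<union> F'" for i
      using that S0 f F(2) h(2) by (auto simp: f'_def)
    have h'S: "h' i \<in> S i" if "i \<in> F \<union> F'" for i
      using that S0 h F(2) by (auto simp: h'_def Pi_def)
    let ?d = "\<lambda>i. f' i \<oplus>\<^bsub>R\<^esub> \<ominus>\<^bsub>R\<^esub> h' i"
    have "finsum R f' (F \<union> F') = finsum R h' (F \<union> F')"
      using ext[OF F(1) h(1) fc] ext[OF h(1) F(1) hc] h(4)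
      unfolding f'_def h'_def by (simp add: Un_commute)
    moreover have "finsum R (\<lambda>i. ?d i \<oplus>\<^bsub>R\<^esub> h' i) (F \<union> F') = finsum R ?d (F \<union> F') \<oplus>\<^bsub>R\<^esub> finsum R h' (F \<union> F')"
      using f'c h'c by (intro finsum_addf) auto
    moreover have "?d i \<oplus>\<^bsub>R\<^esub> h' i = f' i" for i using f'c h'c by (simp add: a_assoc l_neg)
    ultimately have "finsum R h' (F \<union> F') = finsum R ?d (F \<union> F') \<oplus>\<^bsub>R\<^esub> finsum R h' (F \<union> F')" by simp
    moreover have "finsum R h' (F \<union> F') \<in> carrier R" "finsum R ?d (F \<union> F') \<in> carrier R"
      using f'c h'c by (auto intro!: finsum_closed)
    ultimately have "finsum R ?d (F \<union> F') = \<zero>\<^bsub>R\<^esub>"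
      using add.r_cancel_one'[simplified] by blast
    moreover have "?d \<in> (\<Pi> i\<in>F \<union> F'. S i)"
    proof
      fix j assume j: "j \<in> F \<union> F'"
      then interpret Sj: additive_subgroup "S j" R using Ssub(2) F(2) h(2) by blast
      have "\<ominus>\<^bsub>R\<^esub> h' j \<in> S j"
        using h'S[OF j] subgroup.m_inv_closed[OF Sj.a_subgroup] by (simp add: a_inv_def)
      then show "?d j \<in> S j" using f'S[OF j] by simp
    qed
    ultimately have "?d i = \<zero>\<^bsub>R\<^esub>"
      using direct_sum F h(1,2) i unfolding is_direct_sum_def
      by (metis (no_types, lifting) UnI1 Un_least finite_UnI)
    then have "f' i = h' i" using f'c h'c by (metis a_inv_closed minus_equality minus_minus)
    then have "f i \<in> J" using h'J i by (metis f'_def)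
    then show "g i = \<zero>\<^bsub>?Q\<^esub>" using f(2)[OF i] pJ Jc Q0 by simp
  qed
  have idc: "e \<in> carrier \<Gamma>" if "e \<in> identities \<Gamma>" for e
    using that gdom_closed by (auto simp: identities_def)
  have unit: "is_local_unit R S e (local_unit R S e)" if "e \<in> identities \<Gamma>" for e
    using ex_local_unit[OF that] local_unit_eq by metis
  have uc: "local_unit R S e \<in> carrier R" if "e \<in> identities \<Gamma>" for e
    using unit[OF that] Ssub(1)[OF idc[OF that]] by (auto simp: is_local_unit_def)
  have Qunit: "is_local_unit ?Q (quotient_grading R S J) e (p (local_unit R S e))"
    if e: "e \<in> identities \<Gamma>" for e
    using unit[OF e] uc[OF e] Ssub(1)[OF idc[OF e]]
    by (auto simp: is_local_unit_def qg Qmult subset_iff)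
  show ?thesis
  proof (intro graded_ring.intro graded_ring_axioms.intro Qring groupoid_axioms ds)
    fix \<gamma> \<delta> a b
    assume gd: "\<gamma> \<in> carrier \<Gamma>" "\<delta> \<in> carrier \<Gamma>"
      and "a \<in> quotient_grading R S J \<gamma>" "b \<in> quotient_grading R S J \<delta>"
    then obtain x y where xy: "x \<in> S \<gamma>" "y \<in> S \<delta>" "a = p x" "b = p y" by (auto simp: qg)
    then have m: "a \<otimes>\<^bsub>?Q\<^esub> b = p (x \<otimes>\<^bsub>R\<^esub> y)" using gd Ssub(1) Qmult by blast
    show "a \<otimes>\<^bsub>?Q\<^esub> b \<in> quotient_grading R S J (\<gamma> \<star>\<^bsub>\<Gamma>\<^esub> \<delta>)" if "gdom \<Gamma> \<gamma> = gran \<Gamma> \<delta>"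
      using mult_homogeneous[OF gd that xy(1,2)] m by (auto simp: qg)
    show "a \<otimes>\<^bsub>?Q\<^esub> b = \<zero>\<^bsub>?Q\<^esub>" if "gdom \<Gamma> \<gamma> \<noteq> gran \<Gamma> \<delta>"
      using mult_homogeneous_zero[OF gd that xy(1,2)] m pJ[of "\<zero>\<^bsub>R\<^esub>"] by (simp add: Q0)
  next
    fix e assume "e \<in> identities \<Gamma>"
    then show "\<exists>u. is_local_unit ?Q (quotient_grading R S J) e u" using Qunit by blast
  next
    fix \<gamma> a assume g: "\<gamma> \<in> carrier \<Gamma>" and "a \<in> quotient_grading R S J \<gamma>"
    then obtain x where x: "x \<in> S \<gamma>" "a = p x" by (auto simp: qg)
    then have xc: "x \<in> carrier R" using Ssub(1)[OF g] by blast
    have e: "gran \<Gamma> \<gamma> \<in> identities \<Gamma>" "gdom \<Gamma> \<gamma> \<in> identities \<Gamma>"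
      using g by (auto simp: identities_eq_gran) (simp add: identities_def flip: identities_eq_gran)
    show "local_unit ?Q (quotient_grading R S J) (gran \<Gamma> \<gamma>) \<otimes>\<^bsub>?Q\<^esub> a = a"
      using local_unit_left[OF g x(1)] by (simp add: local_unit_eq[OF Qunit[OF e(1)]] x Qmult xc uc e)
    show "a \<otimes>\<^bsub>?Q\<^esub> local_unit ?Q (quotient_grading R S J) (gdom \<Gamma> \<gamma>) = a"
      using local_unit_right[OF g x(1)] by (simp add: local_unit_eq[OF Qunit[OF e(2)]] x Qmult xc uc e)
  qed
qed

definition gr_semiprimary ::
    "('g, 'm) groupoid_scheme \<Rightarrow> ('a, 'b) ring_scheme \<Rightarrow> ('g \<Rightarrow> 'a set) \<Rightarrow> bool"
  where "gr_semiprimary \<Gamma> R S \<longleftrightarrow>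
    gr_semisimple \<Gamma> (R Quot gr_radical \<Gamma> R S) (quotient_grading R S (gr_radical \<Gamma> R S)) \<and>
    objectwise_nilpotent \<Gamma> R S (gr_radical \<Gamma> R S)"

end

theory Submission
  imports Defs
begin

text \<open>
  Let \<open>J\<close> be the graded radical. The descending chains \<open>\<one>\<^sub>e J\<^sup>n\<close> and \<open>J\<^sup>m \<one>\<^sub>f\<close> become stable, which makes
  \<open>K = \<Inter>\<^sub>n J\<^sup>n\<close> idempotent. If \<open>K \<noteq> 0\<close>, choose a right ideal \<open>A \<subseteq> \<one>\<^sub>e R\<close> minimal with \<open>A K \<noteq> 0\<close> and a
  homogeneous \<open>a \<in> A\<close> with \<open>a K \<noteq> 0\<close>; then \<open>{y. a y K = 0}\<close> is a gr-maximal right ideal, so it contains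
  \<open>J\<close> and hence \<open>K\<close>, and \<open>a K = a K K = 0\<close>, a contradiction. So \<open>K = 0\<close>, and \<open>J\<close> is objectwise nilpotent.

  The ring \<open>R / J\<close> is gr-semisimple: a minimal right ideal \<open>T \<subseteq> \<one>\<^sub>e R\<close> not contained in the sum of the
  minimal right ideals above \<open>J\<close> would split, modulo \<open>J\<close>, into a simple ideal and a smaller ideal
  \<open>T \<inter> M\<close> with \<open>M\<close> gr-maximal, both contained in that sum.

  For the ascending chain condition, choose \<open>B \<subseteq> \<one>\<^sub>e R\<close> minimal such that ascending chains between \<open>B\<close>
  and \<open>\<one>\<^sub>e R\<close> are stationary. If \<open>B \<noteq> B J\<close>, then \<open>B\<close> has a maximal graded subideal, which contradicts
  minimality; hence \<open>B = B J \<subseteq> K = 0\<close>. The left-hand version is this one for the opposite ring.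
\<close>

text \<open>Frees the symbol \<open><+>\<close> for the sum \<open>set_add\<close> of subgroups,
  which would otherwise clash with the disjoint sum of sets.\<close>

no_notation Sum_Type.Plus (infixr \<open><+>\<close> 65)

section \<open>Additive subgroups\<close>

lemma (in abelian_group) additive_subgroup_iff:
  "additive_subgroup U G \<longleftrightarrow>
    U \<subseteq> carrier G \<and> \<zero> \<in> U \<and> (\<forall>x\<in>U. \<forall>y\<in>U. x \<oplus> y \<in> U) \<and> (\<forall>x\<in>U. \<ominus> x \<in> U)"
proof
  assume "additive_subgroup U G"
  then interpret additive_subgroup U G .
  show "U \<subseteq> carrier G \<and> \<zero> \<in> U \<and> (\<forall>x\<in>U. \<forall>y\<in>U. x \<oplus> y \<in> U) \<and> (\<forall>x\<in>U. \<ominus> x \<in> U)"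
    by auto
next
  assume *: "U \<subseteq> carrier G \<and> \<zero> \<in> U \<and> (\<forall>x\<in>U. \<forall>y\<in>U. x \<oplus> y \<in> U) \<and> (\<forall>x\<in>U. \<ominus> x \<in> U)"
  show "additive_subgroup U G"
    by (rule additive_subgroupI, rule add.subgroupI) (use * in auto)
qed

lemma (in abelian_group) hom_zero_minus:
  assumes "abelian_group H" "f \<in> hom (add_monoid G) (add_monoid H)"
  shows "f \<zero> = \<zero>\<^bsub>H\<^esub>" "x \<in> carrier G \<Longrightarrow> f (\<ominus> x) = \<ominus>\<^bsub>H\<^esub> f x"
proof -
  interpret H: abelian_group H by fact
  interpret group_hom "add_monoid G" "add_monoid H" f
    by (rule group_hom.intro[OF a_group H.a_group group_hom_axioms.intro[OF assms(2)]])
  show "f \<zero> = \<zero>\<^bsub>H\<^esub>" "x \<in> carrier G \<Longrightarrow> f (\<ominus> x) = \<ominus>\<^bsub>H\<^esub> f x"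
    using hom_one hom_inv by (auto simp: a_inv_def)
qed

text \<open>The recurring device for extending a property from generators: the elements satisfying
  it form the preimage of a subgroup under an additive map, so only generators remain to be
  checked.\<close>

lemma (in abelian_group) additive_subgroup_vimage:
  assumes H: "abelian_group H" and f: "f \<in> hom (add_monoid G) (add_monoid H)"
    and U: "additive_subgroup U H"
  shows "additive_subgroup {x \<in> carrier G. f x \<in> U} G"
proof -
  interpret H: abelian_group H by fact
  note hom_zero_minus[OF H f]
  then show ?thesis
    using f U by (auto simp: additive_subgroup_iff H.additive_subgroup_iff hom_def Pi_iff)
qed

text \<open>Serves to compare two additive maps: once they agree on generators, they agree
  everywhere.\<close>

lemma (in abelian_group) additive_subgroup_equalizer:
  assumes H: "abelian_group H"
    and f: "f \<in> hom (add_monoid G) (add_monoid H)" and g: "g \<in> hom (add_monoid G) (add_monoid H)"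
  shows "additive_subgroup {x \<in> carrier G. f x = g x} G"
  using hom_zero_minus[OF H f] hom_zero_minus[OF H g] f g
  by (auto simp: additive_subgroup_iff hom_def)

lemma (in abelian_group) additive_subgroup_image:
  assumes H: "abelian_group H" and f: "f \<in> hom (add_monoid G) (add_monoid H)"
    and U: "additive_subgroup U G"
  shows "additive_subgroup (f ` U) H"
proof -
  interpret H: abelian_group H by fact
  interpret group_hom "add_monoid G" "add_monoid H" f
    by (rule group_hom.intro[OF a_group H.a_group group_hom_axioms.intro[OF f]])
  show ?thesis
    using U subgroup_img_is_subgroup by (auto simp: additive_subgroup_def)
qed

lemma (in abelian_group) mem_set_add_iff:
  "x \<in> U <+> V \<longleftrightarrow> (\<exists>u\<in>U. \<exists>v\<in>V. x = u \<oplus> v)"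
  by (auto simp: set_add_def set_mult_def)

lemma (in abelian_group) set_add_superset:
  assumes "additive_subgroup U G" "additive_subgroup V G"
  shows "U \<subseteq> U <+> V" "V \<subseteq> U <+> V"
proof -
  have "u \<in> U <+> V" if "u \<in> U" for u
    using that assms unfolding mem_set_add_iff
    by (intro bexI[of _ u] bexI[of _ \<zero>]) (auto simp: additive_subgroup_iff subset_iff)
  moreover have "v \<in> U <+> V" if "v \<in> V" for v
    using that assms unfolding mem_set_add_iff
    by (intro bexI[of _ v] bexI[of _ \<zero>]) (auto simp: additive_subgroup_iff subset_iff)
  ultimately show "U \<subseteq> U <+> V" "V \<subseteq> U <+> V" by auto
qed

lemma (in abelian_group) set_add_least:
  fixes U V W :: "'a set"
  assumes "additive_subgroup W G" "U \<subseteq> W" "V \<subseteq> W"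
  shows "U <+> V \<subseteq> W"
  using assms by (auto simp: mem_set_add_iff additive_subgroup_iff) (meson subsetD)

section \<open>Products of subgroups and sums of families in a ring without unit\<close>

context nonunital_ring
begin

lemma mult_left_hom: "a \<in> carrier R \<Longrightarrow> (\<lambda>x. a \<otimes> x) \<in> hom (add_monoid R) (add_monoid R)"
  by (auto simp: hom_def mult_closed right_distrib)

lemma mult_right_hom: "a \<in> carrier R \<Longrightarrow> (\<lambda>x. x \<otimes> a) \<in> hom (add_monoid R) (add_monoid R)"
  by (auto simp: hom_def mult_closed left_distrib)

lemma mult_zero [simp]:
  assumes "a \<in> carrier R" shows "a \<otimes> \<zero> = \<zero>" "\<zero> \<otimes> a = \<zero>"
  using hom_zero_minus(1)[OF abelian_group_axioms] mult_left_hom mult_right_hom assms by auto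

lemma mult_minus:
  assumes "a \<in> carrier R" "b \<in> carrier R"
  shows "a \<otimes> (\<ominus> b) = \<ominus> (a \<otimes> b)" "(\<ominus> a) \<otimes> b = \<ominus> (a \<otimes> b)"
  using hom_zero_minus(2)[OF abelian_group_axioms mult_left_hom[OF assms(1)] assms(2)]
    hom_zero_minus(2)[OF abelian_group_axioms mult_right_hom[OF assms(2)] assms(1)] by auto

lemma additive_subgroup_zero: "additive_subgroup {\<zero>} R"
  by (auto simp: additive_subgroup_iff)

lemma additive_subgroup_carrier: "additive_subgroup (carrier R) R"
  by (auto simp: additive_subgroup_iff)

lemma additive_subgroup_Int:
  "additive_subgroup U R \<Longrightarrow> additive_subgroup V R \<Longrightarrow> additive_subgroup (U \<inter> V) R"
  by (auto simp: additive_subgroup_iff)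

lemma additive_subgroup_mult_left_vimage:
  "a \<in> carrier R \<Longrightarrow> additive_subgroup U R \<Longrightarrow> additive_subgroup {x \<in> carrier R. a \<otimes> x \<in> U} R"
  by (rule additive_subgroup_vimage[OF abelian_group_axioms mult_left_hom])

lemma additive_subgroup_mult_right_vimage:
  "a \<in> carrier R \<Longrightarrow> additive_subgroup U R \<Longrightarrow> additive_subgroup {x \<in> carrier R. x \<otimes> a \<in> U} R"
  by (rule additive_subgroup_vimage[OF abelian_group_axioms mult_right_hom])

lemma l_coset_eq_image: "a <# U = (\<lambda>x. a \<otimes> x) ` U"
  by (auto simp: l_coset_def)

lemma r_coset_eq_image: "U #> a = (\<lambda>x. x \<otimes> a) ` U"
  by (auto simp: r_coset_def)

lemma ideal_prod_least:
  assumes "additive_subgroup W R" "\<And>u v. u \<in> U \<Longrightarrow> v \<in> V \<Longrightarrow> u \<otimes> v \<in> W"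
  shows "ideal_prod R U V \<subseteq> W"
proof
  fix x assume "x \<in> ideal_prod R U V"
  then show "x \<in> W"
    by induction (use assms in \<open>auto simp: additive_subgroup_iff\<close>)
qed

text \<open>\<open>ideal_prod\<close> is generated by products under addition alone. Negatives come
  from moving the sign into the left factor, zero from a product of zeros.\<close>

lemma additive_subgroup_ideal_prod:
  assumes U: "additive_subgroup U R" and V: "additive_subgroup V R"
  shows "additive_subgroup (ideal_prod R U V) R"
proof -
  have sub: "U \<subseteq> carrier R" "V \<subseteq> carrier R" "\<zero> \<in> U" "\<zero> \<in> V"
    using U V by (auto simp: additive_subgroup_iff)
  have prodc: "ideal_prod R U V \<subseteq> carrier R"
    by (rule ideal_prod_least[OF additive_subgroup_carrier]) (use sub mult_closed in auto)
  have "\<ominus> x \<in> ideal_prod R U V" if "x \<in> ideal_prod R U V" for x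
    using that
  proof induction
    case (prod u v)
    then have "\<ominus> u \<otimes> v \<in> ideal_prod R U V"
      using U by (intro ideal_prod.prod) (auto simp: additive_subgroup_iff)
    then show ?case using mult_minus(2)[of u v] prod sub by (simp add: subset_iff)
  next
    case (sum x y)
    then show ?case using ideal_prod.sum[OF sum.IH] prodc minus_add[of x y] by (simp add: subset_iff)
  qed
  moreover have "\<zero> \<in> ideal_prod R U V"
    using ideal_prod.prod[of \<zero> U \<zero> V R] sub by simp
  ultimately show ?thesis
    using prodc ideal_prod.sum by (auto simp: additive_subgroup_iff)
qed

lemma ideal_prod_mono: "U \<subseteq> U' \<Longrightarrow> V \<subseteq> V' \<Longrightarrow> ideal_prod R U V \<subseteq> ideal_prod R U' V'"
proof
  fix x assume "U \<subseteq> U'" "V \<subseteq> V'" "x \<in> ideal_prod R U V"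
  from this(3,1,2) show "x \<in> ideal_prod R U' V'"
    by induction (auto intro: ideal_prod.intros)
qed

lemma ideal_prod_assoc_subset:
  assumes "additive_subgroup U R" "additive_subgroup V R" "additive_subgroup W R"
  shows "ideal_prod R (ideal_prod R U V) W \<subseteq> ideal_prod R U (ideal_prod R V W)"
proof (rule ideal_prod_least)
  have sub: "U \<subseteq> carrier R" "V \<subseteq> carrier R" "W \<subseteq> carrier R"
    using assms by (auto simp: additive_subgroup_iff)
  show T: "additive_subgroup (ideal_prod R U (ideal_prod R V W)) R"
    using assms additive_subgroup_ideal_prod by auto
  fix x w assume x: "x \<in> ideal_prod R U V" and w: "w \<in> W"
  \<comment> \<open>For fixed \<open>w\<close>, the elements that \<open>w\<close> multiplies into
    the target form a subgroup, so it is enough to treat a generator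
    \<open>u \<otimes> v\<close>.\<close>
  have "ideal_prod R U V \<subseteq> {x \<in> carrier R. x \<otimes> w \<in> ideal_prod R U (ideal_prod R V W)}"
  proof (rule ideal_prod_least)
    show "additive_subgroup {x \<in> carrier R. x \<otimes> w \<in> ideal_prod R U (ideal_prod R V W)} R"
      by (rule additive_subgroup_mult_right_vimage[OF _ T]) (use w sub in auto)
    fix u v assume uv: "u \<in> U" "v \<in> V"
    then have "u \<otimes> v \<otimes> w = u \<otimes> (v \<otimes> w)" using w sub by (intro mult_assoc) auto
    also have "\<dots> \<in> ideal_prod R U (ideal_prod R V W)"
      using uv w by (intro ideal_prod.prod) auto
    finally show "u \<otimes> v \<in> {x \<in> carrier R. x \<otimes> w \<in> ideal_prod R U (ideal_prod R V W)}"
      using uv sub mult_closed[of u v] by auto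
  qed
  then show "x \<otimes> w \<in> ideal_prod R U (ideal_prod R V W)" using x by auto
qed

text \<open>The two finite sums may have different index sets. Both summand functions are extended
  by zero to the union, where they add termwise.\<close>

lemma family_sum_add:
  assumes A: "\<And>i. i \<in> I \<Longrightarrow> additive_subgroup (A i) R"
    and x: "x \<in> family_sum R I A" and y: "y \<in> family_sum R I A"
  shows "x \<oplus> y \<in> family_sum R I A"
proof -
  obtain f F where f: "finite F" "F \<subseteq> I" "f \<in> (\<Pi> i\<in>F. A i)" "x = finsum R f F"
    using x unfolding family_sum_def by blast
  obtain g G where g: "finite G" "G \<subseteq> I" "g \<in> (\<Pi> i\<in>G. A i)" "y = finsum R g G"
    using y unfolding family_sum_def by blast
  define f' where "f' i = (if i \<in> F then f i else \<zero>)" for i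
  define g' where "g' i = (if i \<in> G then g i else \<zero>)" for i
  have Ac: "A i \<subseteq> carrier R" "\<zero> \<in> A i" "\<And>u v. u \<in> A i \<Longrightarrow> v \<in> A i \<Longrightarrow> u \<oplus> v \<in> A i"
    if "i \<in> I" for i
    using A[OF that] by (auto simp: additive_subgroup_iff)
  have fc: "f i \<in> carrier R" if "i \<in> F" for i using f(2,3) Ac(1) that by blast
  have gc: "g i \<in> carrier R" if "i \<in> G" for i using g(2,3) Ac(1) that by blast
  have f'A: "f' i \<in> A i" if "i \<in> I" for i using f(3) Ac(2)[OF that] by (auto simp: f'_def)
  have g'A: "g' i \<in> A i" if "i \<in> I" for i using g(3) Ac(2)[OF that] by (auto simp: g'_def)
  have "x = finsum R f' (F \<union> G)"
    unfolding f(4) by (rule add.finprod_mono_neutral_cong_left)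
      (use f(1) g(1) fc in \<open>auto simp: f'_def\<close>)
  moreover have "y = finsum R g' (F \<union> G)"
    unfolding g(4) by (rule add.finprod_mono_neutral_cong_left)
      (use g(1) f(1) gc in \<open>auto simp: g'_def\<close>)
  moreover have "finsum R (\<lambda>i. f' i \<oplus> g' i) (F \<union> G) = finsum R f' (F \<union> G) \<oplus> finsum R g' (F \<union> G)"
    by (rule finsum_addf) (use f'A g'A Ac(1) f(2) g(2) in blast)+
  ultimately have "x \<oplus> y = finsum R (\<lambda>i. f' i \<oplus> g' i) (F \<union> G)" by simp
  moreover have "(\<lambda>i. f' i \<oplus> g' i) \<in> (\<Pi> i\<in>F \<union> G. A i)" "F \<union> G \<subseteq> I" "finite (F \<union> G)"
    using f'A g'A Ac(3) f(1,2) g(1,2) by auto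
  ultimately show ?thesis unfolding family_sum_def by blast
qed

lemma family_sum_member:
  assumes "i \<in> I" "A i \<subseteq> carrier R" "x \<in> A i"
  shows "x \<in> family_sum R I A"
proof -
  have "x = finsum R (\<lambda>_. x) {i}" using assms by auto
  moreover have "(\<lambda>_. x) \<in> (\<Pi> i\<in>{i}. A i)" using assms by auto
  ultimately show ?thesis using assms(1) unfolding family_sum_def by blast
qed

lemma family_sum_least:
  assumes "additive_subgroup U R" "\<And>i. i \<in> I \<Longrightarrow> A i \<subseteq> U"
  shows "family_sum R I A \<subseteq> U"
proof
  fix x assume "x \<in> family_sum R I A"
  then obtain f F where f: "finite F" "F \<subseteq> I" "f \<in> (\<Pi> i\<in>F. A i)" "x = finsum R f F"
    unfolding family_sum_def by blast
  have "finsum R f F \<in> U" using f(1-3)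
  proof (induction F)
    case empty
    then show ?case using assms by (auto simp: additive_subgroup_iff)
  next
    case (insert i F)
    then have fU: "f j \<in> U" if "j \<in> insert i F" for j using assms(2) that by blast
    then have "f \<in> F \<rightarrow> carrier R" "f i \<in> carrier R"
      using assms(1) by (auto simp: additive_subgroup_iff)
    then show ?case using insert fU assms(1) by (simp add: additive_subgroup_iff)
  qed
  then show "x \<in> U" using f by simp
qed

lemma additive_subgroup_family_sum:
  assumes A: "\<And>i. i \<in> I \<Longrightarrow> additive_subgroup (A i) R"
  shows "additive_subgroup (family_sum R I A) R"
proof -
  have sub: "family_sum R I A \<subseteq> carrier R"
    by (rule family_sum_least[OF additive_subgroup_carrier]) (use A in \<open>auto simp: additive_subgroup_iff\<close>)
  have z: "\<zero> \<in> family_sum R I A"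
  proof -
    have "\<zero> = finsum R (\<lambda>_. \<zero>) {}" by simp
    then show ?thesis unfolding family_sum_def by blast
  qed
  have "\<ominus> finsum R f F \<in> family_sum R I A" if "finite F" "F \<subseteq> I" "f \<in> (\<Pi> i\<in>F. A i)" for f F
    using that
  proof (induction F)
    case empty
    have "\<ominus> \<zero> = \<zero>" by (rule minus_equality) simp_all
    then show ?case using z by (simp only: finsum_empty)
  next
    case (insert i F)
    have Ac: "A j \<subseteq> carrier R" if "j \<in> I" for j
      using A[OF that] by (auto simp: additive_subgroup_iff)
    have fc: "f \<in> F \<rightarrow> carrier R" "f i \<in> carrier R" "f i \<in> A i" "i \<in> I"
      using insert Ac by blast+
    then have "\<ominus> f i \<in> A i" using A[of i] by (auto simp: additive_subgroup_iff)
    then have "\<ominus> f i \<in> family_sum R I A" using fc Ac by (intro family_sum_member) auto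
    moreover have "\<ominus> finsum R f F \<in> family_sum R I A" using insert by auto
    ultimately show ?case
      using insert fc family_sum_add[OF A] minus_add[of "f i" "finsum R f F"] by simp
  qed
  then have "\<ominus> x \<in> family_sum R I A" if "x \<in> family_sum R I A" for x
    using that unfolding family_sum_def by fastforce
  then show ?thesis
    using sub z family_sum_add[OF A] by (auto simp: additive_subgroup_iff)
qed

end

section \<open>The opposite graded ring\<close>

text \<open>Domain and range are exchanged along with the order of composition, while the morphisms
  stay the same. Hence the same \<open>S\<close> grades the opposite ring.\<close>

definition op_groupoid :: "('g, 'm) groupoid_scheme \<Rightarrow> ('g, 'm) groupoid_scheme" where
  "op_groupoid \<Gamma> =
    \<Gamma>\<lparr>gcomp := (\<lambda>\<gamma> \<delta>. \<delta> \<star>\<^bsub>\<Gamma>\<^esub> \<gamma>), gdom := gran \<Gamma>, gran := gdom \<Gamma>\<rparr>"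

text \<open>Only the multiplication is updated, so addition, finite sums, subgroups and direct sums
  are literally those of \<open>R\<close>.\<close>

definition op_ring :: "('a, 'b) ring_scheme \<Rightarrow> ('a, 'b) ring_scheme" where
  "op_ring R = R\<lparr>mult := (\<lambda>x y. y \<otimes>\<^bsub>R\<^esub> x)\<rparr>"

lemma op_groupoid_simps [simp]:
  "carrier (op_groupoid \<Gamma>) = carrier \<Gamma>"
  "\<gamma> \<star>\<^bsub>op_groupoid \<Gamma>\<^esub> \<delta> = \<delta> \<star>\<^bsub>\<Gamma>\<^esub> \<gamma>"
  "gdom (op_groupoid \<Gamma>) = gran \<Gamma>"
  "gran (op_groupoid \<Gamma>) = gdom \<Gamma>"
  by (simp_all add: op_groupoid_def)

lemma op_ring_simps [simp]:
  "carrier (op_ring R) = carrier R"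
  "x \<otimes>\<^bsub>op_ring R\<^esub> y = y \<otimes>\<^bsub>R\<^esub> x"
  "zero (op_ring R) = zero R"
  "add (op_ring R) = add R"
  "a_inv (op_ring R) = a_inv R"
  "finsum (op_ring R) = finsum R"
  "additive_subgroup U (op_ring R) \<longleftrightarrow> additive_subgroup U R"
  by (simp_all add: op_ring_def a_inv_def finsum_def additive_subgroup_def)

lemma add_monoid_op_ring [simp]: "add_monoid (op_ring R) = add_monoid R"
  by (simp add: op_ring_def)

lemma groupoid_op: "groupoid \<Gamma> \<Longrightarrow> groupoid (op_groupoid \<Gamma>)"
  unfolding groupoid_def by simp metis

lemma nonunital_ring_op:
  assumes "nonunital_ring R" shows "nonunital_ring (op_ring R)"
proof -
  interpret nonunital_ring R by fact
  have "abelian_group (op_ring R)"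
    using abelian_group_axioms
    by (simp add: abelian_group_def abelian_monoid_def abelian_group_axioms_def)
  then show ?thesis
    by (intro nonunital_ring.intro nonunital_ring_axioms.intro)
      (simp_all add: mult_closed mult_assoc left_distrib right_distrib)
qed

lemma is_direct_sum_op [simp]: "is_direct_sum (op_ring R) = is_direct_sum R"
  by (simp add: is_direct_sum_def family_sum_def fun_eq_iff)

lemma is_local_unit_op [simp]: "is_local_unit (op_ring R) S e u \<longleftrightarrow> is_local_unit R S e u"
  by (auto simp: is_local_unit_def)

lemma local_unit_op [simp]: "local_unit (op_ring R) S e = local_unit R S e"
  by (simp add: local_unit_def)

lemma (in groupoid) identities_op [simp]: "identities (op_groupoid \<Gamma>) = identities \<Gamma>"
  unfolding identities_eq_gran by (simp add: identities_def)

lemma graded_right_ideal_op [simp]: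
  "graded_right_ideal (op_groupoid \<Gamma>) (op_ring R) S U \<longleftrightarrow> graded_left_ideal \<Gamma> R S U"
  by (simp add: graded_right_ideal_def graded_left_ideal_def right_ideal_def left_ideal_def is_graded_def)

lemma graded_left_ideal_op [simp]:
  "graded_left_ideal (op_groupoid \<Gamma>) (op_ring R) S U \<longleftrightarrow> graded_right_ideal \<Gamma> R S U"
  by (simp add: graded_right_ideal_def graded_left_ideal_def right_ideal_def left_ideal_def is_graded_def)

lemma r_coset_op [simp]: "U #>\<^bsub>op_ring R\<^esub> a = a <#\<^bsub>R\<^esub> U"
  by (simp add: l_coset_def r_coset_def)

lemma l_coset_op [simp]: "a <#\<^bsub>op_ring R\<^esub> U = U #>\<^bsub>R\<^esub> a"
  by (simp add: l_coset_def r_coset_def)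

lemma graded_ring_op:
  assumes "graded_ring \<Gamma> R S" shows "graded_ring (op_groupoid \<Gamma>) (op_ring R) S"
proof -
  interpret graded_ring \<Gamma> R S by fact
  show ?thesis
    by (intro graded_ring.intro graded_ring_axioms.intro groupoid_op groupoid_axioms
        nonunital_ring_op nonunital_ring_axioms)
      (simp_all add: direct_sum mult_homogeneous mult_homogeneous_zero ex_local_unit
        local_unit_left local_unit_right)
qed

text \<open>Allows every left-hand statement to be read off from its right-hand counterpart.\<close>

lemma chain_conditions_op:
  assumes "graded_ring \<Gamma> R S"
  shows "right_\<Gamma>0_artinian (op_groupoid \<Gamma>) (op_ring R) S \<longleftrightarrow> left_\<Gamma>0_artinian \<Gamma> R S"
    "left_\<Gamma>0_artinian (op_groupoid \<Gamma>) (op_ring R) S \<longleftrightarrow> right_\<Gamma>0_artinian \<Gamma> R S"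
    "right_\<Gamma>0_noetherian (op_groupoid \<Gamma>) (op_ring R) S \<longleftrightarrow> left_\<Gamma>0_noetherian \<Gamma> R S"
proof -
  interpret graded_ring \<Gamma> R S by fact
  show "right_\<Gamma>0_artinian (op_groupoid \<Gamma>) (op_ring R) S \<longleftrightarrow> left_\<Gamma>0_artinian \<Gamma> R S"
    "left_\<Gamma>0_artinian (op_groupoid \<Gamma>) (op_ring R) S \<longleftrightarrow> right_\<Gamma>0_artinian \<Gamma> R S"
    "right_\<Gamma>0_noetherian (op_groupoid \<Gamma>) (op_ring R) S \<longleftrightarrow> left_\<Gamma>0_noetherian \<Gamma> R S"
    by (simp_all add: right_\<Gamma>0_artinian_def left_\<Gamma>0_artinian_def right_\<Gamma>0_noetherian_def
        left_\<Gamma>0_noetherian_def)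
qed

section \<open>Homogeneous components\<close>

text \<open>Has the assumptions of \<open>graded_ring\<close>, with \<open>R\<close> as implicit
  structure. Its notions are interpreted later for the opposite ring and for quotients as
  well.\<close>

locale graded_ring_struct = graded_ring \<Gamma> R S
  for \<Gamma> :: "('g, 'm) groupoid_scheme" and R :: "('a, 'b) ring_scheme" (structure) and S :: "'g \<Rightarrow> 'a set"
begin

text \<open>The family of components is a total function that vanishes off a finite subset of the
  groupoid. This makes the function itself unique, and not only its values on a chosen index
  set.\<close>

definition decomposes :: "'a \<Rightarrow> ('g \<Rightarrow> 'a) \<Rightarrow> bool" where
  "decomposes x f \<longleftrightarrow> finite {\<gamma>. f \<gamma> \<noteq> \<zero>} \<and> {\<gamma>. f \<gamma> \<noteq> \<zero>} \<subseteq> carrier \<Gamma> \<and>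
    (\<forall>\<gamma>\<in>carrier \<Gamma>. f \<gamma> \<in> S \<gamma>) \<and> x = finsum R f {\<gamma>. f \<gamma> \<noteq> \<zero>}"

definition component :: "'a \<Rightarrow> 'g \<Rightarrow> 'a" where
  "component x = (SOME f. decomposes x f)"

lemma S_subgroup: "\<gamma> \<in> carrier \<Gamma> \<Longrightarrow> additive_subgroup (S \<gamma>) R"
  using direct_sum by (simp add: is_direct_sum_def)

lemma
  assumes "\<gamma> \<in> carrier \<Gamma>"
  shows S_carrier: "a \<in> S \<gamma> \<Longrightarrow> a \<in> carrier R"
    and S_zero: "\<zero> \<in> S \<gamma>"
    and S_add: "a \<in> S \<gamma> \<Longrightarrow> b \<in> S \<gamma> \<Longrightarrow> a \<oplus> b \<in> S \<gamma>"
    and S_minus: "a \<in> S \<gamma> \<Longrightarrow> \<ominus> a \<in> S \<gamma>"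
  using S_subgroup[OF assms] by (auto simp: additive_subgroup_iff)

lemma decomposes_finsum:
  assumes f: "decomposes x f" and F: "finite F" "{\<gamma>. f \<gamma> \<noteq> \<zero>} \<subseteq> F"
  shows "x = finsum R f F"
proof -
  have "f \<gamma> \<in> carrier R" for \<gamma>
    using f S_carrier[of \<gamma> "f \<gamma>"] by (cases "f \<gamma> = \<zero>") (auto simp: decomposes_def)
  then have "finsum R f {\<gamma>. f \<gamma> \<noteq> \<zero>} = finsum R f F"
    using F by (intro add.finprod_mono_neutral_cong_left) auto
  then show ?thesis using f by (simp add: decomposes_def)
qed

lemma decomposesI:
  assumes "finite F" "F \<subseteq> carrier \<Gamma>" "\<And>\<gamma>. \<gamma> \<in> F \<Longrightarrow> f \<gamma> \<in> S \<gamma>" "\<And>\<gamma>. \<gamma> \<notin> F \<Longrightarrow> f \<gamma> = \<zero>"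
    "x = finsum R f F"
  shows "decomposes x f"
  unfolding decomposes_def
proof (intro conjI ballI)
  have c: "f \<gamma> \<in> carrier R" for \<gamma> using assms(2-4) S_carrier by (cases "\<gamma> \<in> F") auto
  show "x = finsum R f {\<gamma>. f \<gamma> \<noteq> \<zero>}"
    unfolding assms(5) using assms(1,4) c by (intro add.finprod_mono_neutral_cong_right) auto
  show "finite {\<gamma>. f \<gamma> \<noteq> \<zero>}" using assms(1) by (rule finite_subset[rotated]) (use assms(4) in auto)
  show "{\<gamma>. f \<gamma> \<noteq> \<zero>} \<subseteq> carrier \<Gamma>" using assms(2,4) by auto
  show "f \<gamma> \<in> S \<gamma>" if "\<gamma> \<in> carrier \<Gamma>" for \<gamma>
    using that assms(3,4) S_zero by (cases "\<gamma> \<in> F") auto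
qed

lemma decomposes_add:
  assumes f: "decomposes x f" and g: "decomposes y g"
  shows "decomposes (x \<oplus> y) (\<lambda>\<gamma>. f \<gamma> \<oplus> g \<gamma>)"
proof (rule decomposesI)
  let ?F = "{\<gamma>. f \<gamma> \<noteq> \<zero>} \<union> {\<gamma>. g \<gamma> \<noteq> \<zero>}"
  show F: "finite ?F" "?F \<subseteq> carrier \<Gamma>" using f g by (auto simp: decomposes_def)
  show "f \<gamma> \<oplus> g \<gamma> \<in> S \<gamma>" if "\<gamma> \<in> ?F" for \<gamma>
    by (rule S_add) (use that F f g in \<open>auto simp: decomposes_def\<close>)
  show "f \<gamma> \<oplus> g \<gamma> = \<zero>" if "\<gamma> \<notin> ?F" for \<gamma> using that by auto
  have c: "f \<gamma> \<in> carrier R" "g \<gamma> \<in> carrier R" if "\<gamma> \<in> ?F" for \<gamma>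
    using f g F that S_carrier[of \<gamma>] by (auto simp: decomposes_def)
  have "x = finsum R f ?F" "y = finsum R g ?F"
    using F f g by (auto intro: decomposes_finsum)
  then show "x \<oplus> y = (\<Oplus>\<gamma>\<in>?F. f \<gamma> \<oplus> g \<gamma>)"
    using c by (simp add: finsum_addf Pi_def)
qed

lemma decomposes_minus:
  assumes f: "decomposes x f"
  shows "decomposes (\<ominus> x) (\<lambda>\<gamma>. \<ominus> f \<gamma>)"
proof (rule decomposesI)
  let ?F = "{\<gamma>. f \<gamma> \<noteq> \<zero>}"
  show F: "finite ?F" "?F \<subseteq> carrier \<Gamma>" using f by (auto simp: decomposes_def)
  show "\<ominus> f \<gamma> \<in> S \<gamma>" if "\<gamma> \<in> ?F" for \<gamma>
    by (rule S_minus) (use that F f in \<open>auto simp: decomposes_def\<close>)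
  show "\<ominus> f \<gamma> = \<zero>" if "\<gamma> \<notin> ?F" for \<gamma> using that by (simp add: add.inv_one)
  have c: "f \<gamma> \<in> carrier R" if "\<gamma> \<in> ?F" for \<gamma>
    using f F that S_carrier[of \<gamma>] by (auto simp: decomposes_def)
  have "finsum R (\<lambda>\<gamma>. \<ominus> f \<gamma> \<oplus> f \<gamma>) ?F = finsum R (\<lambda>\<gamma>. \<ominus> f \<gamma>) ?F \<oplus> finsum R f ?F"
    using c by (intro finsum_addf) auto
  moreover have "finsum R (\<lambda>\<gamma>. \<ominus> f \<gamma> \<oplus> f \<gamma>) ?F = \<zero>"
    using c by (intro add.finprod_one_eqI) (auto simp: l_neg)
  moreover have "finsum R f ?F \<in> carrier R" "finsum R (\<lambda>\<gamma>. \<ominus> f \<gamma>) ?F \<in> carrier R"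
    using c by (auto intro!: finsum_closed)
  ultimately show "\<ominus> x = finsum R (\<lambda>\<gamma>. \<ominus> f \<gamma>) ?F"
    using decomposes_finsum[OF f F(1)] minus_equality by fastforce
qed

text \<open>The difference of two decompositions of \<open>x\<close> decomposes zero, so it vanishes
  by directness of the sum.\<close>

lemma decomposes_unique:
  assumes f: "decomposes x f" and g: "decomposes x g"
  shows "f = g"
proof
  fix \<gamma>
  have c: "f \<gamma> \<in> carrier R" "g \<gamma> \<in> carrier R"
    using f g S_carrier[of \<gamma>]
    by (cases "f \<gamma> = \<zero>", auto simp: decomposes_def) (cases "g \<gamma> = \<zero>", auto simp: decomposes_def)
  have x: "x \<in> carrier R"
    using f S_carrier unfolding decomposes_def by (auto intro!: finsum_closed)
  let ?h = "\<lambda>\<gamma>. f \<gamma> \<oplus> \<ominus> g \<gamma>"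
  have h: "decomposes \<zero> ?h"
    using decomposes_add[OF f decomposes_minus[OF g]] x by (simp add: r_neg)
  have "?h \<gamma> = \<zero>"
  proof (rule ccontr)
    assume "?h \<gamma> \<noteq> \<zero>"
    let ?F = "{\<gamma>. ?h \<gamma> \<noteq> \<zero>}"
    have "finite ?F \<and> ?F \<subseteq> carrier \<Gamma> \<and> ?h \<in> (\<Pi> i\<in>?F. S i) \<and> finsum R ?h ?F = \<zero>"
      using h unfolding decomposes_def by auto
    then have "\<forall>i\<in>?F. ?h i = \<zero>"
      using direct_sum unfolding is_direct_sum_def by meson
    then show False using \<open>?h \<gamma> \<noteq> \<zero>\<close> by auto
  qed
  then show "f \<gamma> = g \<gamma>" using c minus_equality minus_minus by (metis a_inv_closed)
qed

lemma decomposes_exists: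
  assumes "x \<in> carrier R" shows "\<exists>f. decomposes x f"
proof -
  obtain f F where f: "finite F" "F \<subseteq> carrier \<Gamma>" "f \<in> (\<Pi> i\<in>F. S i)" "x = finsum R f F"
    using direct_sum assms unfolding is_direct_sum_def family_sum_def by auto
  then have c: "f \<gamma> \<in> carrier R" if "\<gamma> \<in> F" for \<gamma> using that S_carrier by blast
  have "decomposes x (\<lambda>\<gamma>. if \<gamma> \<in> F then f \<gamma> else \<zero>)"
  proof (rule decomposesI[OF f(1,2)])
    show "x = (\<Oplus>\<gamma>\<in>F. if \<gamma> \<in> F then f \<gamma> else \<zero>)"
      unfolding f(4) using c by (intro finsum_cong') auto
  qed (use f in auto)
  then show ?thesis by blast
qed

lemma decomposes_component: "x \<in> carrier R \<Longrightarrow> decomposes x (component x)"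
  unfolding component_def by (rule someI_ex[OF decomposes_exists])

lemma component_eqI: "decomposes x f \<Longrightarrow> component x = f"
  unfolding component_def by (rule some_equality) (auto intro: decomposes_unique)

lemma component_closed: "x \<in> carrier R \<Longrightarrow> \<gamma> \<in> carrier \<Gamma> \<Longrightarrow> component x \<gamma> \<in> S \<gamma>"
  using decomposes_component by (auto simp: decomposes_def)

lemma component_carrier: "x \<in> carrier R \<Longrightarrow> \<gamma> \<in> carrier \<Gamma> \<Longrightarrow> component x \<gamma> \<in> carrier R"
  using component_closed S_carrier by blast

lemma component_add:
  "x \<in> carrier R \<Longrightarrow> y \<in> carrier R \<Longrightarrow> component (x \<oplus> y) \<gamma> = component x \<gamma> \<oplus> component y \<gamma>"
  using component_eqI[OF decomposes_add[OF decomposes_component decomposes_component]] by simp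

lemma component_hom:
  "\<gamma> \<in> carrier \<Gamma> \<Longrightarrow> (\<lambda>x. component x \<gamma>) \<in> hom (add_monoid R) (add_monoid R)"
  by (auto simp: hom_def component_add component_carrier)

lemma component_homogeneous:
  assumes "\<gamma> \<in> carrier \<Gamma>" "x \<in> S \<gamma>"
  shows "component x \<delta> = (if \<delta> = \<gamma> then x else \<zero>)"
proof -
  have "decomposes x (\<lambda>\<delta>. if \<delta> = \<gamma> then x else \<zero>)"
    by (rule decomposesI[of "{\<gamma>}"]) (use assms S_carrier in auto)
  then show ?thesis by (simp add: component_eqI)
qed

lemma component_zero: "component \<zero> \<gamma> = \<zero>"
proof -
  have "decomposes \<zero> (\<lambda>_. \<zero>)" by (rule decomposesI[of "{}"]) auto
  then show ?thesis by (simp add: component_eqI)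
qed

section \<open>Graded subgroups\<close>

text \<open>Closure under components is the working form of gradedness; it passes directly to
  intersections and preimages.\<close>

definition graded_subgroup :: "'a set \<Rightarrow> bool" where
  "graded_subgroup U \<longleftrightarrow> additive_subgroup U R \<and> (\<forall>x\<in>U. \<forall>\<gamma>\<in>carrier \<Gamma>. component x \<gamma> \<in> U)"

text \<open>An element is the sum of its components, which gives one direction. For the other, the
  elements whose component in a fixed degree lies in \<open>U\<close> form a subgroup containing
  every \<open>U \<inter> S \<delta>\<close>.\<close>

lemma graded_subgroup_iff: "graded_subgroup U \<longleftrightarrow> additive_subgroup U R \<and> is_graded \<Gamma> R S U"
proof (intro iffI conjI)
  assume U: "graded_subgroup U"
  then show sub: "additive_subgroup U R" by (simp add: graded_subgroup_def)
  have int: "additive_subgroup (U \<inter> S \<gamma>) R" if "\<gamma> \<in> carrier \<Gamma>" for \<gamma>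
    using that sub S_subgroup by (intro additive_subgroup_Int)
  show "is_graded \<Gamma> R S U"
    unfolding is_graded_def is_direct_sum_def
  proof (intro conjI ballI allI impI int)
    show "U = family_sum R (carrier \<Gamma>) (\<lambda>\<gamma>. U \<inter> S \<gamma>)"
    proof
      show "family_sum R (carrier \<Gamma>) (\<lambda>\<gamma>. U \<inter> S \<gamma>) \<subseteq> U"
        by (rule family_sum_least[OF sub]) auto
      show "U \<subseteq> family_sum R (carrier \<Gamma>) (\<lambda>\<gamma>. U \<inter> S \<gamma>)"
      proof
        fix x assume x: "x \<in> U"
        then have xR: "x \<in> carrier R" using sub by (auto simp: additive_subgroup_iff)
        let ?F = "{\<gamma>. component x \<gamma> \<noteq> \<zero>}"
        have d: "finite ?F" "?F \<subseteq> carrier \<Gamma>" "x = finsum R (component x) ?F"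
          using decomposes_component[OF xR] by (auto simp: decomposes_def)
        moreover have "component x \<in> (\<Pi> \<gamma>\<in>?F. U \<inter> S \<gamma>)"
          using U x xR d(2) component_closed by (auto simp: graded_subgroup_def)
        ultimately show "x \<in> family_sum R (carrier \<Gamma>) (\<lambda>\<gamma>. U \<inter> S \<gamma>)"
          unfolding family_sum_def by blast
      qed
    qed
    show "f i = \<zero>" if "finite F \<and> F \<subseteq> carrier \<Gamma> \<and> f \<in> (\<Pi> \<gamma>\<in>F. U \<inter> S \<gamma>) \<and> finsum R f F = \<zero>" "i \<in> F"
      for F f i
    proof -
      have "finite F \<and> F \<subseteq> carrier \<Gamma> \<and> f \<in> (\<Pi> \<gamma>\<in>F. S \<gamma>) \<and> finsum R f F = \<zero>" using that by auto
      then have "\<forall>i\<in>F. f i = \<zero>" using direct_sum unfolding is_direct_sum_def by meson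
      then show ?thesis using that by auto
    qed
  qed
next
  assume U: "additive_subgroup U R \<and> is_graded \<Gamma> R S U"
  have "U \<subseteq> {x \<in> carrier R. component x \<gamma> \<in> U}" if \<gamma>: "\<gamma> \<in> carrier \<Gamma>" for \<gamma>
  proof -
    have V: "additive_subgroup {x \<in> carrier R. component x \<gamma> \<in> U} R"
      by (rule additive_subgroup_vimage[OF abelian_group_axioms component_hom[OF \<gamma>]]) (use U in auto)
    have "family_sum R (carrier \<Gamma>) (\<lambda>\<gamma>. U \<inter> S \<gamma>) \<subseteq> {x \<in> carrier R. component x \<gamma> \<in> U}"
    proof (rule family_sum_least[OF V], rule subsetI)
      fix \<delta> x assume "\<delta> \<in> carrier \<Gamma>" "x \<in> U \<inter> S \<delta>"
      then show "x \<in> {x \<in> carrier R. component x \<gamma> \<in> U}"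
        using U S_carrier by (auto simp: component_homogeneous additive_subgroup_iff)
    qed
    then show ?thesis using U unfolding is_graded_def is_direct_sum_def by argo
  qed
  then show "graded_subgroup U" using U by (auto simp: graded_subgroup_def)
qed

lemma graded_subgroup_carrier: "graded_subgroup (carrier R)"
  by (auto simp: graded_subgroup_def additive_subgroup_carrier component_carrier)

text \<open>The reduction to homogeneous elements: a graded subgroup is generated by its homogeneous
  elements, so \<open>V\<close> only has to contain those.\<close>

lemma graded_subgroup_subset:
  assumes U: "graded_subgroup U" and V: "additive_subgroup V R"
    and hom: "\<And>\<gamma> x. \<gamma> \<in> carrier \<Gamma> \<Longrightarrow> x \<in> U \<Longrightarrow> x \<in> S \<gamma> \<Longrightarrow> x \<in> V"
  shows "U \<subseteq> V"
proof -
  have "U = family_sum R (carrier \<Gamma>) (\<lambda>\<gamma>. U \<inter> S \<gamma>)"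
    using U unfolding graded_subgroup_iff is_graded_def is_direct_sum_def by blast
  also have "\<dots> \<subseteq> V" by (rule family_sum_least[OF V]) (use hom in auto)
  finally show ?thesis .
qed

lemma not_subset_homogeneous:
  assumes "graded_subgroup U" "additive_subgroup V R" "\<not> U \<subseteq> V"
  obtains \<gamma> x where "\<gamma> \<in> carrier \<Gamma>" "x \<in> U" "x \<in> S \<gamma>" "x \<notin> V"
  using graded_subgroup_subset[OF assms(1,2)] assms(3) by blast

lemma additive_subgroup_components:
  assumes "additive_subgroup U R"
  shows "additive_subgroup {x \<in> carrier R. \<forall>\<gamma>\<in>carrier \<Gamma>. component x \<gamma> \<in> U} R"
proof -
  have "component (\<ominus> x) \<gamma> = \<ominus> component x \<gamma>" if "x \<in> carrier R" "\<gamma> \<in> carrier \<Gamma>" for x \<gamma>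
    using hom_zero_minus(2)[OF abelian_group_axioms component_hom] that by auto
  then show ?thesis
    using assms by (auto simp: additive_subgroup_iff component_add component_zero)
qed

text \<open>A subgroup is graded as soon as it is generated by homogeneous elements.\<close>

lemma graded_subgroupI:
  assumes U: "additive_subgroup U R"
    and gen: "\<And>V. additive_subgroup V R \<Longrightarrow> (\<And>\<gamma> x. \<gamma> \<in> carrier \<Gamma> \<Longrightarrow> x \<in> U \<Longrightarrow> x \<in> S \<gamma> \<Longrightarrow> x \<in> V) \<Longrightarrow> U \<subseteq> V"
  shows "graded_subgroup U"
proof -
  have "U \<subseteq> {x \<in> carrier R. \<forall>\<gamma>\<in>carrier \<Gamma>. component x \<gamma> \<in> U}"
  proof (rule gen[OF additive_subgroup_components[OF U]])
    fix \<gamma> x assume "\<gamma> \<in> carrier \<Gamma>" "x \<in> U" "x \<in> S \<gamma>"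
    then show "x \<in> {x \<in> carrier R. \<forall>\<gamma>\<in>carrier \<Gamma>. component x \<gamma> \<in> U}"
      using U S_carrier by (auto simp: component_homogeneous additive_subgroup_iff)
  qed
  then show ?thesis using U by (auto simp: graded_subgroup_def)
qed

lemma graded_subgroup_Int:
  "graded_subgroup U \<Longrightarrow> graded_subgroup V \<Longrightarrow> graded_subgroup (U \<inter> V)"
  by (auto simp: graded_subgroup_def additive_subgroup_Int)

lemma graded_subgroup_zero: "graded_subgroup {\<zero>}"
  by (auto simp: graded_subgroup_def additive_subgroup_zero component_zero)

lemma graded_subgroup_set_add:
  assumes U: "graded_subgroup U" and V: "graded_subgroup V"
  shows "graded_subgroup (U <+> V)"
proof (rule graded_subgroupI)
  have sub: "additive_subgroup U R" "additive_subgroup V R"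
    using U V by (auto simp: graded_subgroup_def)
  then show "additive_subgroup (U <+> V) R" by (rule add_additive_subgroups)
  fix W assume W: "additive_subgroup W R"
    and hom: "\<And>\<gamma> x. \<gamma> \<in> carrier \<Gamma> \<Longrightarrow> x \<in> U <+> V \<Longrightarrow> x \<in> S \<gamma> \<Longrightarrow> x \<in> W"
  have "U \<subseteq> W" "V \<subseteq> W"
    using graded_subgroup_subset[OF U W] graded_subgroup_subset[OF V W] hom set_add_superset[OF sub]
    by blast+
  with W show "U <+> V \<subseteq> W" by (rule set_add_least)
qed

text \<open>If the degrees do not compose, the product is zero and any degree serves.\<close>

lemma homogeneous_mult:
  assumes "\<gamma> \<in> carrier \<Gamma>" "a \<in> S \<gamma>" "\<delta> \<in> carrier \<Gamma>" "b \<in> S \<delta>"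
  shows "\<exists>\<epsilon>\<in>carrier \<Gamma>. a \<otimes> b \<in> S \<epsilon>"
proof (cases "gdom \<Gamma> \<gamma> = gran \<Gamma> \<delta>")
  case True
  then show ?thesis
    using assms mult_homogeneous gcomp_closed by blast
next
  case False
  then show ?thesis
    using assms mult_homogeneous_zero[of \<gamma> \<delta> a b] S_zero by auto
qed

lemma graded_subgroup_mult_left_image:
  assumes a: "\<gamma> \<in> carrier \<Gamma>" "a \<in> S \<gamma>" and U: "graded_subgroup U"
  shows "graded_subgroup (a <# U)"
  unfolding l_coset_eq_image
proof (rule graded_subgroupI)
  have aR: "a \<in> carrier R" using a S_carrier by blast
  have sub: "additive_subgroup U R" using U by (simp add: graded_subgroup_def)
  then show "additive_subgroup ((\<lambda>x. a \<otimes> x) ` U) R"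
    by (rule additive_subgroup_image[OF abelian_group_axioms mult_left_hom[OF aR]])
  fix V assume V: "additive_subgroup V R"
    and hom: "\<And>\<gamma> x. \<gamma> \<in> carrier \<Gamma> \<Longrightarrow> x \<in> (\<lambda>x. a \<otimes> x) ` U \<Longrightarrow> x \<in> S \<gamma> \<Longrightarrow> x \<in> V"
  have "U \<subseteq> {x \<in> carrier R. a \<otimes> x \<in> V}"
  proof (rule graded_subgroup_subset[OF U additive_subgroup_mult_left_vimage[OF aR V]])
    fix \<delta> x assume x: "\<delta> \<in> carrier \<Gamma>" "x \<in> U" "x \<in> S \<delta>"
    then obtain \<epsilon> where "\<epsilon> \<in> carrier \<Gamma>" "a \<otimes> x \<in> S \<epsilon>" using homogeneous_mult a by blast
    then show "x \<in> {x \<in> carrier R. a \<otimes> x \<in> V}" using hom x S_carrier by blast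
  qed
  then show "(\<lambda>x. a \<otimes> x) ` U \<subseteq> V" by auto
qed

lemma graded_subgroup_ideal_prod:
  assumes U: "graded_subgroup U" and V: "graded_subgroup V"
  shows "graded_subgroup (ideal_prod R U V)"
proof (rule graded_subgroupI)
  have sub: "additive_subgroup U R" "additive_subgroup V R"
    using U V by (auto simp: graded_subgroup_def)
  have subc: "U \<subseteq> carrier R" "V \<subseteq> carrier R" using sub by (auto simp: additive_subgroup_iff)
  show "additive_subgroup (ideal_prod R U V) R" using sub by (rule additive_subgroup_ideal_prod)
  fix W assume W: "additive_subgroup W R"
    and hom: "\<And>\<gamma> x. \<gamma> \<in> carrier \<Gamma> \<Longrightarrow> x \<in> ideal_prod R U V \<Longrightarrow> x \<in> S \<gamma> \<Longrightarrow> x \<in> W"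
  \<comment> \<open>The reduction to homogeneous elements is applied to one factor at a time: first
    to \<open>v\<close> with \<open>u\<close> homogeneous, then to \<open>u\<close> with
    \<open>v\<close> arbitrary.\<close>
  have *: "V \<subseteq> {v \<in> carrier R. u \<otimes> v \<in> W}" if u: "\<gamma> \<in> carrier \<Gamma>" "u \<in> U" "u \<in> S \<gamma>" for \<gamma> u
  proof (rule graded_subgroup_subset[OF V additive_subgroup_mult_left_vimage[OF _ W]])
    show "u \<in> carrier R" using u subc by auto
    fix \<delta> v assume v: "\<delta> \<in> carrier \<Gamma>" "v \<in> V" "v \<in> S \<delta>"
    then obtain \<epsilon> where "\<epsilon> \<in> carrier \<Gamma>" "u \<otimes> v \<in> S \<epsilon>" using homogeneous_mult u by blast
    then show "v \<in> {v \<in> carrier R. u \<otimes> v \<in> W}"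
      using hom ideal_prod.prod[of u U v V R] v u subc by blast
  qed
  have "U \<subseteq> {u \<in> carrier R. u \<otimes> v \<in> W}" if v: "v \<in> V" for v
    by (rule graded_subgroup_subset[OF U additive_subgroup_mult_right_vimage[OF _ W]])
      (use v subc * in blast)+
  then show "ideal_prod R U V \<subseteq> W" by (intro ideal_prod_least W) blast
qed

section \<open>Components of products with a homogeneous element\<close>

lemma gcomp_left_cancel:
  assumes "\<gamma> \<in> carrier \<Gamma>" "\<delta> \<in> carrier \<Gamma>" "\<epsilon> \<in> carrier \<Gamma>"
    "gdom \<Gamma> \<gamma> = gran \<Gamma> \<delta>" "gdom \<Gamma> \<gamma> = gran \<Gamma> \<epsilon>" "\<gamma> \<star>\<^bsub>\<Gamma>\<^esub> \<delta> = \<gamma> \<star>\<^bsub>\<Gamma>\<^esub> \<epsilon>"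
  shows "\<delta> = \<epsilon>"
proof -
  obtain \<eta> where \<eta>: "\<eta> \<in> carrier \<Gamma>" "gdom \<Gamma> \<eta> = gran \<Gamma> \<gamma>" "\<eta> \<star>\<^bsub>\<Gamma>\<^esub> \<gamma> = gdom \<Gamma> \<gamma>"
    using invertible[OF assms(1)] by blast
  have *: "\<eta> \<star>\<^bsub>\<Gamma>\<^esub> (\<gamma> \<star>\<^bsub>\<Gamma>\<^esub> \<zeta>) = \<zeta>" if "\<zeta> \<in> carrier \<Gamma>" "gdom \<Gamma> \<gamma> = gran \<Gamma> \<zeta>" for \<zeta>
    unfolding gcomp_assoc[OF \<eta>(1) assms(1) that(1) \<eta>(2) that(2), symmetric] \<eta>(3) that(2)
    by (rule gran_gcomp_self[OF that(1)])
  show ?thesis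
    by (rule trans[OF *[OF assms(2,4), symmetric, unfolded assms(6)] *[OF assms(3,5)]])
qed

text \<open>Both sides are additive in \<open>x\<close>, so \<open>x\<close> may be taken
  homogeneous. Left cancellation in the groupoid then ensures that no other degree than \<delta>
  contributes to the product degree.\<close>

lemma component_mult_left:
  assumes \<gamma>: "\<gamma> \<in> carrier \<Gamma>" and \<delta>: "\<delta> \<in> carrier \<Gamma>" and gd: "gdom \<Gamma> \<gamma> = gran \<Gamma> \<delta>"
    and a: "a \<in> S \<gamma>" and x: "x \<in> carrier R"
  shows "component (a \<otimes> x) (\<gamma> \<star>\<^bsub>\<Gamma>\<^esub> \<delta>) = a \<otimes> component x \<delta>"
proof -
  have aR: "a \<in> carrier R" using a \<gamma> S_carrier by blast
  let ?f = "\<lambda>x. component (a \<otimes> x) (\<gamma> \<star>\<^bsub>\<Gamma>\<^esub> \<delta>)" and ?g = "\<lambda>x. a \<otimes> component x \<delta>"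
  have \<gamma>\<delta>: "\<gamma> \<star>\<^bsub>\<Gamma>\<^esub> \<delta> \<in> carrier \<Gamma>" using gcomp_closed \<gamma> \<delta> gd by blast
  have hom: "?f \<in> hom (add_monoid R) (add_monoid R)" "?g \<in> hom (add_monoid R) (add_monoid R)"
    using aR \<gamma>\<delta> \<delta> by (auto simp: hom_def component_add component_carrier mult_closed right_distrib)
  from additive_subgroup_equalizer[OF abelian_group_axioms hom] have "carrier R \<subseteq> {x \<in> carrier R. ?f x = ?g x}"
  proof (rule graded_subgroup_subset[OF graded_subgroup_carrier])
    fix \<epsilon> x assume x: "\<epsilon> \<in> carrier \<Gamma>" "x \<in> carrier R" "x \<in> S \<epsilon>"
    show "x \<in> {x \<in> carrier R. ?f x = ?g x}"
    proof (cases "gdom \<Gamma> \<gamma> = gran \<Gamma> \<epsilon>")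
      case True
      then have "a \<otimes> x \<in> S (\<gamma> \<star>\<^bsub>\<Gamma>\<^esub> \<epsilon>)" "\<gamma> \<star>\<^bsub>\<Gamma>\<^esub> \<epsilon> \<in> carrier \<Gamma>"
        using mult_homogeneous a x \<gamma> gcomp_closed by auto
      moreover have "\<gamma> \<star>\<^bsub>\<Gamma>\<^esub> \<delta> = \<gamma> \<star>\<^bsub>\<Gamma>\<^esub> \<epsilon> \<longleftrightarrow> \<delta> = \<epsilon>"
        using gcomp_left_cancel \<gamma> \<delta> x(1) gd True by blast
      ultimately show ?thesis using x aR by (auto simp: component_homogeneous)
    next
      case False
      then have "a \<otimes> x = \<zero>" "\<delta> \<noteq> \<epsilon>" using mult_homogeneous_zero a x \<gamma> gd by auto
      then show ?thesis using x aR by (auto simp: component_homogeneous component_zero)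
    qed
  qed
  then show ?thesis using x by blast
qed

text \<open>If \<gamma> and \<delta> compose, \<open>a \<otimes> component x \<delta>\<close> is a
  component of \<open>a \<otimes> x\<close> and so lies in \<open>U\<close>; otherwise it is
  zero.\<close>

lemma graded_subgroup_mult_left_vimage:
  assumes a: "\<gamma> \<in> carrier \<Gamma>" "a \<in> S \<gamma>" and U: "graded_subgroup U"
  shows "graded_subgroup {x \<in> carrier R. a \<otimes> x \<in> U}"
  unfolding graded_subgroup_def
proof (intro conjI ballI)
  have aR: "a \<in> carrier R" using a S_carrier by blast
  have sub: "additive_subgroup U R" using U by (simp add: graded_subgroup_def)
  then show "additive_subgroup {x \<in> carrier R. a \<otimes> x \<in> U} R"
    by (rule additive_subgroup_mult_left_vimage[OF aR])
  fix x \<delta> assume x: "x \<in> {x \<in> carrier R. a \<otimes> x \<in> U}" and \<delta>: "\<delta> \<in> carrier \<Gamma>"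
  have "a \<otimes> component x \<delta> \<in> U"
  proof (cases "gdom \<Gamma> \<gamma> = gran \<Gamma> \<delta>")
    case True
    then have "\<gamma> \<star>\<^bsub>\<Gamma>\<^esub> \<delta> \<in> carrier \<Gamma>" using a \<delta> gcomp_closed by blast
    moreover have "a \<otimes> x \<in> U" using x by simp
    ultimately have "component (a \<otimes> x) (\<gamma> \<star>\<^bsub>\<Gamma>\<^esub> \<delta>) \<in> U"
      using U unfolding graded_subgroup_def by blast
    then show ?thesis
      using component_mult_left[OF a(1) \<delta> True a(2), of x] x by simp
  next
    case False
    then have "a \<otimes> component x \<delta> = \<zero>"
      using mult_homogeneous_zero a \<delta> component_closed x by blast
    then show ?thesis using sub by (auto simp: additive_subgroup_iff)
  qed
  then show "component x \<delta> \<in> {x \<in> carrier R. a \<otimes> x \<in> U}" using x \<delta> component_carrier by auto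
qed

section \<open>Transfer to the opposite ring\<close>

lemma op_struct: "graded_ring_struct (op_groupoid \<Gamma>) (op_ring R) S"
  using graded_ring_op graded_ring_axioms by (simp add: graded_ring_struct_def)

lemma op_graded_subgroup [simp]:
  "graded_ring_struct.graded_subgroup (op_groupoid \<Gamma>) (op_ring R) S U \<longleftrightarrow> graded_subgroup U"
proof -
  interpret op: graded_ring_struct "op_groupoid \<Gamma>" "op_ring R" S by (rule op_struct)
  show ?thesis by (simp add: op.graded_subgroup_iff graded_subgroup_iff is_graded_def)
qed

lemma graded_subgroup_mult_right_vimage:
  assumes "\<gamma> \<in> carrier \<Gamma>" "a \<in> S \<gamma>" "graded_subgroup U"
  shows "graded_subgroup {x \<in> carrier R. x \<otimes> a \<in> U}"
  using graded_ring_struct.graded_subgroup_mult_left_vimage[OF op_struct, of \<gamma> a U] assms by simp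

section \<open>Graded one-sided ideals\<close>

abbreviation unit_at :: "'g \<Rightarrow> 'a" (\<open>\<one>\<^sub>_\<close> [1000] 1000)
  where "\<one>\<^sub>e \<equiv> local_unit R S e"

abbreviation right_gr_ideal :: "'a set \<Rightarrow> bool"
  where "right_gr_ideal \<equiv> graded_right_ideal \<Gamma> R S"

lemma right_gr_ideal_iff:
  "right_gr_ideal U \<longleftrightarrow> graded_subgroup U \<and> (\<forall>u\<in>U. \<forall>a\<in>carrier R. u \<otimes> a \<in> U)"
  by (auto simp: graded_right_ideal_def right_ideal_def graded_subgroup_iff)

lemma left_gr_ideal_iff:
  "graded_left_ideal \<Gamma> R S U \<longleftrightarrow> graded_subgroup U \<and> (\<forall>u\<in>U. \<forall>a\<in>carrier R. a \<otimes> u \<in> U)"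
  by (auto simp: graded_left_ideal_def left_ideal_def graded_subgroup_iff)

lemma
  assumes "right_gr_ideal U"
  shows right_gr_ideal_graded: "graded_subgroup U"
    and right_gr_ideal_sub: "additive_subgroup U R"
    and right_gr_ideal_carrier: "U \<subseteq> carrier R"
    and right_gr_ideal_mult: "u \<in> U \<Longrightarrow> a \<in> carrier R \<Longrightarrow> u \<otimes> a \<in> U"
    and right_gr_ideal_zero: "\<zero> \<in> U"
  using assms by (auto simp: right_gr_ideal_iff graded_subgroup_def additive_subgroup_iff)

lemma gdom_identity: "\<gamma> \<in> carrier \<Gamma> \<Longrightarrow> gdom \<Gamma> \<gamma> \<in> identities \<Gamma>"
  by (simp add: identities_def)

lemma gran_identity: "\<gamma> \<in> carrier \<Gamma> \<Longrightarrow> gran \<Gamma> \<gamma> \<in> identities \<Gamma>"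
  by (simp add: identities_eq_gran)

lemma identity_carrier: "e \<in> identities \<Gamma> \<Longrightarrow> e \<in> carrier \<Gamma>"
  using gdom_closed by (auto simp: identities_def)

lemma unit_homogeneous: "e \<in> identities \<Gamma> \<Longrightarrow> \<one>\<^sub>e \<in> S e"
  using ex_local_unit local_unit_eq is_local_unit_def by metis

lemma unit_carrier: "e \<in> identities \<Gamma> \<Longrightarrow> \<one>\<^sub>e \<in> carrier R"
  using unit_homogeneous identity_carrier S_carrier by blast

lemma homogeneous_mem_unit:
  assumes "\<gamma> \<in> carrier \<Gamma>" "x \<in> S \<gamma>"
  shows "x \<in> \<one>\<^sub>(gran \<Gamma> \<gamma>) <# carrier R"
  using local_unit_left[OF assms] S_carrier[OF assms] by (force simp: l_coset_eq_image)

text \<open>Without a global unit this is not automatic: the local unit at the domain of the degree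
  fixes \<open>x\<close> on the right.\<close>

lemma homogeneous_mem_principal:
  assumes "\<gamma> \<in> carrier \<Gamma>" "x \<in> S \<gamma>"
  shows "x \<in> x <# carrier R"
proof -
  have "x = x \<otimes> \<one>\<^sub>(gdom \<Gamma> \<gamma>)" using local_unit_right[OF assms] by simp
  then show ?thesis using unit_carrier[OF gdom_identity[OF assms(1)]] by (force simp: l_coset_eq_image)
qed

lemma right_gr_ideal_all: "right_gr_ideal (carrier R)"
  by (simp add: right_gr_ideal_iff graded_subgroup_carrier mult_closed)

lemma right_gr_ideal_Int: "right_gr_ideal U \<Longrightarrow> right_gr_ideal V \<Longrightarrow> right_gr_ideal (U \<inter> V)"
  by (simp add: right_gr_ideal_iff graded_subgroup_Int)

lemma right_gr_ideal_set_add: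
  assumes U: "right_gr_ideal U" and V: "right_gr_ideal V"
  shows "right_gr_ideal (U <+> V)"
proof -
  have "(u \<oplus> v) \<otimes> a \<in> U <+> V" if "u \<in> U" "v \<in> V" "a \<in> carrier R" for u v a
  proof -
    have "(u \<oplus> v) \<otimes> a = u \<otimes> a \<oplus> v \<otimes> a"
      using that right_gr_ideal_carrier[OF U] right_gr_ideal_carrier[OF V] by (intro left_distrib) auto
    then show ?thesis
      using right_gr_ideal_mult[OF U that(1,3)] right_gr_ideal_mult[OF V that(2,3)]
      unfolding mem_set_add_iff by (intro bexI[of _ "u \<otimes> a"] bexI[of _ "v \<otimes> a"])
  qed
  then show ?thesis
    using assms unfolding right_gr_ideal_iff by (auto simp: graded_subgroup_set_add mem_set_add_iff)
qed

lemma right_gr_ideal_mult_left_image: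
  assumes a: "\<gamma> \<in> carrier \<Gamma>" "a \<in> S \<gamma>" and U: "right_gr_ideal U"
  shows "right_gr_ideal (a <# U)"
proof -
  have "a \<otimes> u \<otimes> b \<in> a <# U" if "u \<in> U" "b \<in> carrier R" for u b
  proof -
    have "a \<otimes> u \<otimes> b = a \<otimes> (u \<otimes> b)"
      using that right_gr_ideal_carrier[OF U] S_carrier[OF a] by (intro mult_assoc) auto
    then show ?thesis using that right_gr_ideal_mult[OF U] by (auto simp: l_coset_eq_image)
  qed
  then show ?thesis
    using graded_subgroup_mult_left_image[OF a right_gr_ideal_graded[OF U]]
    unfolding right_gr_ideal_iff by (auto simp: l_coset_eq_image)
qed

lemma right_gr_ideal_principal:
  assumes "\<gamma> \<in> carrier \<Gamma>" "a \<in> S \<gamma>"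
  shows "right_gr_ideal (a <# carrier R)"
  using right_gr_ideal_mult_left_image[OF assms right_gr_ideal_all] .

lemma right_gr_ideal_unit: "e \<in> identities \<Gamma> \<Longrightarrow> right_gr_ideal (\<one>\<^sub>e <# carrier R)"
  using right_gr_ideal_principal[OF identity_carrier unit_homogeneous] by blast

lemma principal_least: "right_gr_ideal U \<Longrightarrow> a \<in> U \<Longrightarrow> a <# carrier R \<subseteq> U"
  using right_gr_ideal_mult by (auto simp: l_coset_eq_image)

lemma right_gr_ideal_mult_left_vimage:
  assumes a: "\<gamma> \<in> carrier \<Gamma>" "a \<in> S \<gamma>" and U: "right_gr_ideal U"
  shows "right_gr_ideal {x \<in> carrier R. a \<otimes> x \<in> U}"
  using graded_subgroup_mult_left_vimage[OF a right_gr_ideal_graded[OF U]] right_gr_ideal_mult[OF U]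
    S_carrier[OF a]
  by (auto simp: right_gr_ideal_iff mult_closed simp flip: mult_assoc)

lemma right_gr_ideal_ideal_prod:
  assumes U: "graded_subgroup U" and V: "right_gr_ideal V"
  shows "right_gr_ideal (ideal_prod R U V)"
proof -
  have T: "graded_subgroup (ideal_prod R U V)"
    using graded_subgroup_ideal_prod[OF U right_gr_ideal_graded[OF V]] .
  have sub: "U \<subseteq> carrier R" "V \<subseteq> carrier R"
    using U right_gr_ideal_carrier[OF V] by (auto simp: graded_subgroup_def additive_subgroup_iff)
  have "ideal_prod R U V \<subseteq> {x \<in> carrier R. x \<otimes> a \<in> ideal_prod R U V}" if a: "a \<in> carrier R" for a
  proof (rule ideal_prod_least[OF additive_subgroup_mult_right_vimage[OF a]])
    show "additive_subgroup (ideal_prod R U V) R" using T by (simp add: graded_subgroup_def)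
    fix u v assume uv: "u \<in> U" "v \<in> V"
    then have "u \<otimes> (v \<otimes> a) \<in> ideal_prod R U V"
      using right_gr_ideal_mult[OF V] a by (intro ideal_prod.prod) auto
    then show "u \<otimes> v \<in> {x \<in> carrier R. x \<otimes> a \<in> ideal_prod R U V}"
      using uv a sub by (auto simp: mult_closed mult_assoc subset_iff)
  qed
  then show ?thesis using T by (auto simp: right_gr_ideal_iff)
qed

lemma left_gr_ideal_ideal_prod:
  assumes U: "graded_left_ideal \<Gamma> R S U" and V: "graded_subgroup V"
  shows "graded_left_ideal \<Gamma> R S (ideal_prod R U V)"
proof -
  have T: "graded_subgroup (ideal_prod R U V)"
    using graded_subgroup_ideal_prod U V unfolding left_gr_ideal_iff by blast
  have sub: "U \<subseteq> carrier R" "V \<subseteq> carrier R"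
    using U V by (auto simp: left_gr_ideal_iff graded_subgroup_def additive_subgroup_iff)
  have "ideal_prod R U V \<subseteq> {x \<in> carrier R. a \<otimes> x \<in> ideal_prod R U V}" if a: "a \<in> carrier R" for a
  proof (rule ideal_prod_least[OF additive_subgroup_mult_left_vimage[OF a]])
    show "additive_subgroup (ideal_prod R U V) R" using T by (simp add: graded_subgroup_def)
    fix u v assume uv: "u \<in> U" "v \<in> V"
    then have "a \<otimes> u \<otimes> v \<in> ideal_prod R U V"
      using U a unfolding left_gr_ideal_iff by (intro ideal_prod.prod) auto
    then show "u \<otimes> v \<in> {x \<in> carrier R. a \<otimes> x \<in> ideal_prod R U V}"
      using uv a sub by (auto simp: mult_closed mult_assoc subset_iff)
  qed
  then show ?thesis using T by (auto simp: left_gr_ideal_iff)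
qed

text \<open>Absence of infinite descending chains makes proper inclusion well-founded on the family,
  which yields a minimal member.\<close>

lemma right_artinian_minimal:
  assumes art: "right_\<Gamma>0_artinian \<Gamma> R S" and e: "e \<in> identities \<Gamma>" and "\<A> \<noteq> {}"
    and \<A>: "\<And>U. U \<in> \<A> \<Longrightarrow> right_gr_ideal U \<and> U \<subseteq> \<one>\<^sub>e <# carrier R"
  shows "\<exists>U\<in>\<A>. \<forall>V\<in>\<A>. V \<subseteq> U \<longrightarrow> V = U"
proof -
  let ?r = "{(V, U). V \<in> \<A> \<and> U \<in> \<A> \<and> V \<subset> U}"
  have wf: "wf ?r"
    unfolding wf_iff_no_infinite_down_chain
  proof
    assume "\<exists>U. \<forall>n. (U (Suc n), U n) \<in> ?r"
    then obtain U where "\<forall>n. U (Suc n) \<in> \<A> \<and> U n \<in> \<A> \<and> U (Suc n) \<subset> U n" by auto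
    then have "\<forall>n. right_gr_ideal (U n) \<and> U n \<subseteq> \<one>\<^sub>e <# carrier R \<and> U (Suc n) \<subset> U n"
      using \<A> by blast
    then show False using art e unfolding right_\<Gamma>0_artinian_def by blast
  qed
  show ?thesis
  proof (rule wfE_min'[OF wf \<open>\<A> \<noteq> {}\<close>])
    fix U assume U: "U \<in> \<A>" and min: "\<And>V. (V, U) \<in> ?r \<Longrightarrow> V \<notin> \<A>"
    show ?thesis using min U by blast
  qed
qed

section \<open>The graded radical\<close>

text \<open>The set is the kernel of the map from \<open>R\<close> to \<open>R / M\<close> given by
  left multiplication by \<open>a\<close>. The last hypothesis says that every nonzero homogeneous
  element in the image of this map generates a submodule containing the class of \<open>a\<close>,
  so the image is gr-simple and its kernel gr-maximal.\<close>

lemma gr_maximal_vimage: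
  assumes a: "\<gamma> \<in> carrier \<Gamma>" "a \<in> S \<gamma>" "a \<notin> M" and M: "right_gr_ideal M"
    and gen: "\<And>\<delta> y. \<delta> \<in> carrier \<Gamma> \<Longrightarrow> y \<in> S \<delta> \<Longrightarrow> a \<otimes> y \<notin> M \<Longrightarrow> a \<in> M <+> (a \<otimes> y <# carrier R)"
  shows "gr_maximal \<Gamma> R S {x \<in> carrier R. a \<otimes> x \<in> M}" (is "gr_maximal \<Gamma> R S ?L")
  unfolding gr_maximal_def
proof (intro conjI allI impI)
  have aR: "a \<in> carrier R" using a S_carrier by blast
  show L: "right_gr_ideal ?L" by (rule right_gr_ideal_mult_left_vimage[OF a(1,2) M])
  \<comment> \<open>The local unit satisfies
    \<open>a \<otimes> \<one>\<^sub>(gdom \<Gamma> \<gamma>) = a\<close>, and \<open>a\<close> is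
    outside \<open>M\<close>; this gives properness.\<close>
  have "\<one>\<^sub>(gdom \<Gamma> \<gamma>) \<notin> ?L" using local_unit_right[OF a(1,2)] a(3) by auto
  then show "?L \<noteq> carrier R" using unit_carrier[OF gdom_identity[OF a(1)]] by auto
  fix N assume N: "right_gr_ideal N \<and> ?L \<subseteq> N"
  show "N = ?L \<or> N = carrier R"
  proof (cases "N \<subseteq> ?L")
    case False
    then obtain \<delta> y where y: "\<delta> \<in> carrier \<Gamma>" "y \<in> N" "y \<in> S \<delta>" "y \<notin> ?L"
      using not_subset_homogeneous[OF right_gr_ideal_graded right_gr_ideal_sub[OF L]] N by blast
    then have yR: "y \<in> carrier R" using S_carrier by blast
    obtain m r where mr: "m \<in> M" "r \<in> carrier R" "a = m \<oplus> a \<otimes> y \<otimes> r"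
      using gen[OF y(1,3)] y(4) yR by (auto simp: mem_set_add_iff l_coset_eq_image)
    have mR: "m \<in> carrier R" using mr right_gr_ideal_carrier[OF M] by auto
    \<comment> \<open>In a unital ring \<open>1 - y r\<close> would lie in the kernel. Here it is
      replaced by \<open>z - y r z\<close> for each \<open>z\<close>; since \<open>y r z\<close>
      lies in \<open>N\<close>, so does \<open>z\<close>.\<close>
    have "z \<in> N" if z: "z \<in> carrier R" for z
    proof -
      have "a \<otimes> z = (m \<oplus> a \<otimes> y \<otimes> r) \<otimes> z" by (rule arg_cong[OF mr(3)])
      also have "\<dots> = m \<otimes> z \<oplus> a \<otimes> (y \<otimes> (r \<otimes> z))"
        using mr(2) mR aR yR z by (simp add: left_distrib mult_closed mult_assoc)
      finally have az: "a \<otimes> z = m \<otimes> z \<oplus> a \<otimes> (y \<otimes> (r \<otimes> z))" .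
      have "a \<otimes> (z \<oplus> \<ominus> (y \<otimes> (r \<otimes> z))) = m \<otimes> z \<oplus> a \<otimes> (y \<otimes> (r \<otimes> z)) \<oplus> \<ominus> (a \<otimes> (y \<otimes> (r \<otimes> z)))"
        unfolding az[symmetric] using aR yR z mr(2) by (simp add: right_distrib mult_closed mult_minus)
      also have "\<dots> = m \<otimes> z" using aR yR z mr(2) mR by (simp add: mult_closed a_assoc r_neg)
      also have "\<dots> \<in> M" using mr z right_gr_ideal_mult[OF M] by blast
      finally have "z \<oplus> \<ominus> (y \<otimes> (r \<otimes> z)) \<in> ?L" using yR z mr(2) by (simp add: mult_closed)
      then have "z \<oplus> \<ominus> (y \<otimes> (r \<otimes> z)) \<in> N" using N by blast
      moreover have "y \<otimes> (r \<otimes> z) \<in> N" using N y z mr(2) right_gr_ideal_mult by (auto simp: mult_closed)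
      ultimately have "z \<oplus> \<ominus> (y \<otimes> (r \<otimes> z)) \<oplus> y \<otimes> (r \<otimes> z) \<in> N"
        using N right_gr_ideal_sub by (auto simp: additive_subgroup_iff)
      then show ?thesis using yR z mr(2) by (simp add: mult_closed a_assoc l_neg)
    qed
    then show ?thesis using right_gr_ideal_carrier N by blast
  qed (use N in blast)
qed

abbreviation rad :: "'a set" where "rad \<equiv> gr_radical \<Gamma> R S"

lemma gr_maximal_right_gr_ideal: "gr_maximal \<Gamma> R S M \<Longrightarrow> right_gr_ideal M"
  by (simp add: gr_maximal_def)

lemma rad_right_gr_ideal: "right_gr_ideal rad"
  using right_gr_ideal_sub[OF gr_maximal_right_gr_ideal]
    right_gr_ideal_graded[OF gr_maximal_right_gr_ideal] right_gr_ideal_mult[OF gr_maximal_right_gr_ideal]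
  by (auto simp: right_gr_ideal_iff graded_subgroup_def gr_radical_def additive_subgroup_iff
      component_carrier mult_closed)

text \<open>For homogeneous \<open>a\<close> outside a gr-maximal \<open>M\<close>, the ideal
  \<open>{x. a \<otimes> x \<in> M}\<close> is again gr-maximal and hence contains the radical,
  which says that \<open>a\<close> multiplies the radical into \<open>M\<close>.\<close>

lemma rad_left_gr_ideal: "graded_left_ideal \<Gamma> R S rad"
proof -
  have "a \<otimes> u \<in> M" if M: "gr_maximal \<Gamma> R S M" and u: "u \<in> rad" and a: "a \<in> carrier R" for a u M
  proof -
    have Mr: "right_gr_ideal M" using M by (simp add: gr_maximal_def)
    have uR: "u \<in> carrier R" using u by (simp add: gr_radical_def)
    have "carrier R \<subseteq> {a \<in> carrier R. a \<otimes> u \<in> M}"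
    proof (rule graded_subgroup_subset[OF graded_subgroup_carrier
          additive_subgroup_mult_right_vimage[OF uR right_gr_ideal_sub[OF Mr]]])
      fix \<gamma> a assume a: "\<gamma> \<in> carrier \<Gamma>" "a \<in> carrier R" "a \<in> S \<gamma>"
      have "a \<otimes> u \<in> M"
      proof (cases "a \<in> M")
        case True
        then show ?thesis using right_gr_ideal_mult[OF Mr] uR by blast
      next
        case False
        have "gr_maximal \<Gamma> R S {x \<in> carrier R. a \<otimes> x \<in> M}"
        proof (rule gr_maximal_vimage[OF a(1,3) False Mr])
          fix \<delta> y assume y: "\<delta> \<in> carrier \<Gamma>" "y \<in> S \<delta>" "a \<otimes> y \<notin> M"
          obtain \<epsilon> where \<epsilon>: "\<epsilon> \<in> carrier \<Gamma>" "a \<otimes> y \<in> S \<epsilon>" using homogeneous_mult a y by blast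
          have P: "right_gr_ideal (a \<otimes> y <# carrier R)" by (rule right_gr_ideal_principal[OF \<epsilon>])
          note sup = set_add_superset[OF right_gr_ideal_sub[OF Mr] right_gr_ideal_sub[OF P]]
          \<comment> \<open>Maximality of \<open>M\<close> makes the sum all of \<open>R\<close>, in
            particular it contains \<open>a\<close>.\<close>
          have "M <+> (a \<otimes> y <# carrier R) \<noteq> M"
            using homogeneous_mem_principal[OF \<epsilon>] sup(2) y(3) by blast
          then have "M <+> (a \<otimes> y <# carrier R) = carrier R"
            using M right_gr_ideal_set_add[OF Mr P] sup(1) unfolding gr_maximal_def by blast
          then show "a \<in> M <+> (a \<otimes> y <# carrier R)" using a by simp
        qed
        then show ?thesis using u unfolding gr_radical_def by blast
      qed
      then show "a \<in> {a \<in> carrier R. a \<otimes> u \<in> M}" using a by simp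
    qed
    then show ?thesis using a by blast
  qed
  then show ?thesis
    using right_gr_ideal_graded[OF rad_right_gr_ideal]
    by (auto simp: left_gr_ideal_iff gr_radical_def mult_closed)
qed

section \<open>Powers of the radical\<close>

text \<open>The exponent is shifted: \<open>rad_power n\<close> is the power with exponent \<open>n + 1\<close>.\<close>

abbreviation rad_power :: "nat \<Rightarrow> 'a set" where "rad_power n \<equiv> ideal_power R rad (Suc n)"

lemma rad_power_0: "rad_power 0 = rad"
  by (simp add: ideal_power_def)

lemma rad_power_Suc: "rad_power (Suc n) = ideal_prod R (rad_power n) rad"
  by (simp add: ideal_power_def)

lemma rad_power_ideal: "right_gr_ideal (rad_power n)" "graded_left_ideal \<Gamma> R S (rad_power n)"
proof (induction n)
  case 0
  show "right_gr_ideal (rad_power 0)" "graded_left_ideal \<Gamma> R S (rad_power 0)"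
    by (simp_all only: rad_power_0 rad_right_gr_ideal rad_left_gr_ideal)
next
  case (Suc n)
  then show "right_gr_ideal (rad_power (Suc n))" "graded_left_ideal \<Gamma> R S (rad_power (Suc n))"
    unfolding rad_power_Suc
    using right_gr_ideal_ideal_prod[OF right_gr_ideal_graded[OF Suc.IH(1)] rad_right_gr_ideal]
      left_gr_ideal_ideal_prod[OF Suc.IH(2) right_gr_ideal_graded[OF rad_right_gr_ideal]] by auto
qed

lemma rad_power_decreasing: "m \<le> n \<Longrightarrow> rad_power n \<subseteq> rad_power m"
proof (induction rule: dec_induct)
  case (step n)
  have "rad_power (Suc n) \<subseteq> rad_power n"
    unfolding rad_power_Suc
    by (rule ideal_prod_least[OF right_gr_ideal_sub[OF rad_power_ideal(1)]])
      (use right_gr_ideal_mult[OF rad_power_ideal(1)] right_gr_ideal_carrier[OF rad_right_gr_ideal] in auto)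
  with step show ?case by blast
qed simp

text \<open>In true exponents, the power n + m + 2 lies in the product of the powers n + 1 and m +
  1; this explains the extra \<open>Suc\<close>. Induction on \<open>m\<close> with reassociation of
  the products.\<close>

lemma rad_power_add_subset: "rad_power (Suc (n + m)) \<subseteq> ideal_prod R (rad_power n) (rad_power m)"
proof (induction m)
  case 0
  show ?case unfolding add_0_right rad_power_Suc rad_power_0 ..
next
  case (Suc m)
  have "rad_power (Suc (n + Suc m)) \<subseteq> ideal_prod R (ideal_prod R (rad_power n) (rad_power m)) rad"
    unfolding rad_power_Suc[of "n + Suc m"] using Suc.IH by (simp only: add_Suc_right ideal_prod_mono)
  also have "\<dots> \<subseteq> ideal_prod R (rad_power n) (rad_power (Suc m))"
    unfolding rad_power_Suc[of m]
    by (intro ideal_prod_assoc_subset right_gr_ideal_sub rad_power_ideal rad_right_gr_ideal)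
  finally show ?case .
qed

section \<open>Stable powers and nilpotence of the radical\<close>

text \<open>A minimal member \<open>\<one>\<^sub>e <# P n\<close> of the descending family equals
  all later ones, and these lie in the corresponding \<open>P k\<close> because each
  \<open>P k\<close> is a left ideal. For earlier \<open>k\<close> monotonicity suffices.\<close>

lemma right_artinian_stable:
  assumes art: "right_\<Gamma>0_artinian \<Gamma> R S" and e: "e \<in> identities \<Gamma>"
    and P: "\<And>n. right_gr_ideal (P n)" "\<And>n. graded_left_ideal \<Gamma> R S (P n)"
    and dec: "\<And>m n. m \<le> n \<Longrightarrow> P n \<subseteq> P m"
  shows "\<exists>n::nat. \<forall>k. \<one>\<^sub>e <# P n \<subseteq> P k"
proof -
  have sub: "\<one>\<^sub>e <# P n \<subseteq> P n" for n
    using P(2)[of n] unit_carrier[OF e] by (auto simp: l_coset_eq_image left_gr_ideal_iff)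
  have "\<exists>U\<in>range (\<lambda>n. \<one>\<^sub>e <# P n). \<forall>V\<in>range (\<lambda>n. \<one>\<^sub>e <# P n). V \<subseteq> U \<longrightarrow> V = U"
  proof (rule right_artinian_minimal[OF art e])
    fix U assume "U \<in> range (\<lambda>n. \<one>\<^sub>e <# P n)"
    then show "right_gr_ideal U \<and> U \<subseteq> \<one>\<^sub>e <# carrier R"
      using right_gr_ideal_mult_left_image[OF identity_carrier[OF e] unit_homogeneous[OF e] P(1)]
        right_gr_ideal_carrier[OF P(1)] by (auto simp: l_coset_eq_image)
  qed simp
  then obtain U where "U \<in> range (\<lambda>n. \<one>\<^sub>e <# P n)"
    and U: "\<forall>V\<in>range (\<lambda>n. \<one>\<^sub>e <# P n). V \<subseteq> U \<longrightarrow> V = U" ..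
  then obtain n where n: "U = \<one>\<^sub>e <# P n" by blast
  have "\<one>\<^sub>e <# P n \<subseteq> P k" for k
  proof (cases "k \<le> n")
    case True
    then show ?thesis using sub dec by blast
  next
    case False
    then have "\<one>\<^sub>e <# P k \<subseteq> U" unfolding n l_coset_eq_image using dec[of n k] by (intro image_mono) simp
    then have "\<one>\<^sub>e <# P k = U" using U by simp
    then show ?thesis using sub[of k] n by simp
  qed
  then show ?thesis by blast
qed

lemma left_artinian_stable:
  assumes "left_\<Gamma>0_artinian \<Gamma> R S" "e \<in> identities \<Gamma>"
    and "\<And>n. right_gr_ideal (P n)" "\<And>n. graded_left_ideal \<Gamma> R S (P n)"
    and "\<And>m n. m \<le> n \<Longrightarrow> P n \<subseteq> P m"
  shows "\<exists>n::nat. \<forall>k. P n #> \<one>\<^sub>e \<subseteq> P k"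
  using graded_ring_struct.right_artinian_stable[OF op_struct, of e P] assms
  by (simp add: chain_conditions_op[OF graded_ring_axioms])

text \<open>It is enough to annihilate the homogeneous \<open>k\<close> in \<open>K\<close>, and for
  each of these the left annihilator is closed under components.\<close>

lemma graded_subgroup_annihilator:
  assumes K: "graded_subgroup K"
  shows "graded_subgroup {z \<in> carrier R. \<forall>k\<in>K. z \<otimes> k = \<zero>}" (is "graded_subgroup ?A")
  unfolding graded_subgroup_def
proof (intro conjI ballI)
  have Kc: "K \<subseteq> carrier R" using K by (auto simp: graded_subgroup_def additive_subgroup_iff)
  have "\<ominus> \<zero> = \<zero>" by (rule minus_equality) simp_all
  then show "additive_subgroup ?A R"
    unfolding additive_subgroup_iff using Kc by (simp add: left_distrib mult_minus subset_iff)
  fix z \<delta> assume z: "z \<in> ?A" and \<delta>: "\<delta> \<in> carrier \<Gamma>"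
  then have zR: "component z \<delta> \<in> carrier R" using component_carrier by auto
  have "K \<subseteq> {k \<in> carrier R. component z \<delta> \<otimes> k \<in> {\<zero>}}"
  proof (rule graded_subgroup_subset[OF K additive_subgroup_mult_left_vimage[OF zR additive_subgroup_zero]])
    fix \<gamma> k assume k: "\<gamma> \<in> carrier \<Gamma>" "k \<in> K" "k \<in> S \<gamma>"
    let ?V = "{x \<in> carrier R. x \<otimes> k \<in> {\<zero>}}"
    have "graded_subgroup ?V"
      by (rule graded_subgroup_mult_right_vimage[OF k(1,3) graded_subgroup_zero])
    moreover have "z \<in> ?V" using z k(2) by simp
    ultimately have "component z \<delta> \<in> ?V" using \<delta> unfolding graded_subgroup_def by fast
    then show "k \<in> {k \<in> carrier R. component z \<delta> \<otimes> k \<in> {\<zero>}}" using k(2) Kc by auto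
  qed
  then show "component z \<delta> \<in> ?A" using zR by auto
qed

lemma idempotent_subset_rad_eq_zero:
  assumes art: "right_\<Gamma>0_artinian \<Gamma> R S"
    and Kr: "right_gr_ideal K" and Kl: "graded_left_ideal \<Gamma> R S K"
    and idem: "K \<subseteq> ideal_prod R K K" and rad: "K \<subseteq> rad"
  shows "K = {\<zero>}"
proof (rule ccontr)
  assume "K \<noteq> {\<zero>}"
  have Kc: "K \<subseteq> carrier R" by (rule right_gr_ideal_carrier[OF Kr])
  \<comment> \<open>\<open>?Z\<close> is the left annihilator of \<open>K\<close>, so a right ideal
    \<open>A\<close> satisfies \<open>A K \<noteq> 0\<close> exactly when it is not contained in
    \<open>?Z\<close>.\<close>
  let ?Z = "{z \<in> carrier R. \<forall>k\<in>K. z \<otimes> k = \<zero>}"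
  have Zg: "graded_subgroup ?Z" by (rule graded_subgroup_annihilator[OF right_gr_ideal_graded[OF Kr]])
  have Z: "right_gr_ideal ?Z"
    using Zg Kl Kc unfolding right_gr_ideal_iff left_gr_ideal_iff
    by (auto simp: mult_closed mult_assoc subset_iff)
  have "\<not> K \<subseteq> {\<zero>}" using \<open>K \<noteq> {\<zero>}\<close> right_gr_ideal_zero[OF Kr] by auto
  then obtain \<gamma> x where x: "\<gamma> \<in> carrier \<Gamma>" "x \<in> K" "x \<in> S \<gamma>" "x \<noteq> \<zero>"
    using not_subset_homogeneous[OF right_gr_ideal_graded[OF Kr] additive_subgroup_zero] by blast
  define e where "e = gran \<Gamma> \<gamma>"
  have e: "e \<in> identities \<Gamma>" using x gran_identity by (simp add: e_def)
  have ex: "\<one>\<^sub>e \<otimes> x = x" using local_unit_left[OF x(1,3)] by (simp add: e_def)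
  let ?\<A> = "{A. right_gr_ideal A \<and> A \<subseteq> \<one>\<^sub>e <# carrier R \<and> \<not> A \<subseteq> ?Z}"
  have "\<one>\<^sub>e \<in> \<one>\<^sub>e <# carrier R"
    by (rule homogeneous_mem_principal[OF identity_carrier[OF e] unit_homogeneous[OF e]])
  \<comment> \<open>The local unit fixes the nonzero element \<open>x\<close> of \<open>K\<close>,
    so it does not annihilate \<open>K\<close>.\<close>
  then have "\<one>\<^sub>e <# carrier R \<in> ?\<A>"
    using right_gr_ideal_unit[OF e] x(2,4) ex by auto
  then have "?\<A> \<noteq> {}" by blast
  then have "\<exists>A\<in>?\<A>. \<forall>B\<in>?\<A>. B \<subseteq> A \<longrightarrow> B = A"
    by (rule right_artinian_minimal[OF art e]) blast
  then obtain A where A: "A \<in> ?\<A>" and Amin: "\<forall>B\<in>?\<A>. B \<subseteq> A \<longrightarrow> B = A" ..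
  have Ar: "right_gr_ideal A" using A by simp
  obtain \<delta> a where a: "\<delta> \<in> carrier \<Gamma>" "a \<in> A" "a \<in> S \<delta>" "a \<notin> ?Z"
    using not_subset_homogeneous[OF right_gr_ideal_graded[OF Ar] right_gr_ideal_sub[OF Z]] A by blast
  have aR: "a \<in> carrier R" using a S_carrier by blast
  have "gr_maximal \<Gamma> R S {y \<in> carrier R. a \<otimes> y \<in> ?Z}"
  proof (rule gr_maximal_vimage[OF a(1,3,4) Z])
    fix \<epsilon> y assume y: "\<epsilon> \<in> carrier \<Gamma>" "y \<in> S \<epsilon>" "a \<otimes> y \<notin> ?Z"
    obtain \<eta> where \<eta>: "\<eta> \<in> carrier \<Gamma>" "a \<otimes> y \<in> S \<eta>" using homogeneous_mult a y by blast
    have P: "right_gr_ideal (a \<otimes> y <# carrier R)" by (rule right_gr_ideal_principal[OF \<eta>])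
    have "a \<otimes> y \<in> A" using a right_gr_ideal_mult[OF Ar] y S_carrier by blast
    then have "a \<otimes> y <# carrier R \<subseteq> A" by (rule principal_least[OF Ar])
    moreover from this have "a \<otimes> y <# carrier R \<in> ?\<A>"
      using P A homogeneous_mem_principal[OF \<eta>] y(3) by blast
    \<comment> \<open>By minimality, a principal right ideal inside \<open>A\<close> that does not
      annihilate \<open>K\<close> is all of \<open>A\<close>, so it contains
      \<open>a\<close>.\<close>
    ultimately have "a \<otimes> y <# carrier R = A" by (rule Amin[rule_format, rotated])
    then have "a \<in> a \<otimes> y <# carrier R" using a(2) by blast
    then show "a \<in> ?Z <+> (a \<otimes> y <# carrier R)"
      using set_add_superset(2)[OF right_gr_ideal_sub[OF Z] right_gr_ideal_sub[OF P]] by (rule subsetD[rotated])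
  qed
  then have "rad \<subseteq> {y \<in> carrier R. a \<otimes> y \<in> ?Z}" unfolding gr_radical_def by blast
  then have zero: "a \<otimes> k \<otimes> k' = \<zero>" if "k \<in> K" "k' \<in> K" for k k'
    using that rad by blast
  \<comment> \<open>So far \<open>a\<close> kills products of two elements of \<open>K\<close>;
    idempotence turns this into \<open>a\<close> killing \<open>K\<close>.\<close>
  have "ideal_prod R K K \<subseteq> {y \<in> carrier R. a \<otimes> y \<in> {\<zero>}}"
    by (rule ideal_prod_least[OF additive_subgroup_mult_left_vimage[OF aR additive_subgroup_zero]])
      (use zero Kc aR in \<open>auto simp: mult_closed mult_assoc subset_iff\<close>)
  with idem have "K \<subseteq> {y \<in> carrier R. a \<otimes> y \<in> {\<zero>}}" by (rule subset_trans)
  then have "a \<in> ?Z" using aR by auto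
  with a(4) show False by (rule notE)
qed

definition rad_inter :: "'a set" where "rad_inter = (\<Inter>n. rad_power n)"

lemma rad_inter_ideal: "right_gr_ideal rad_inter" "graded_left_ideal \<Gamma> R S rad_inter"
proof -
  have "rad_inter \<subseteq> carrier R"
    unfolding rad_inter_def
    by (rule INF_lower2[OF UNIV_I]) (rule right_gr_ideal_carrier[OF rad_power_ideal(1)[of 0]])
  then have "additive_subgroup rad_inter R"
    using right_gr_ideal_sub[OF rad_power_ideal(1)]
    by (simp add: rad_inter_def additive_subgroup_iff)
  then have "graded_subgroup rad_inter"
    using right_gr_ideal_graded[OF rad_power_ideal(1)]
    by (simp add: graded_subgroup_def rad_inter_def)
  then show "right_gr_ideal rad_inter" "graded_left_ideal \<Gamma> R S rad_inter"
    using rad_power_ideal by (auto simp: right_gr_ideal_iff left_gr_ideal_iff rad_inter_def)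
qed

text \<open>
  If \<open>\<one>\<^sub>e J\<^sup>n\<close> and \<open>J\<^sup>m \<one>\<^sub>f\<close> are both stable, then \<open>\<one>\<^sub>e J\<^sup>n\<^sup>+\<^sup>m \<one>\<^sub>f = (\<one>\<^sub>e J\<^sup>n) (J\<^sup>m \<one>\<^sub>f)\<close> exhibits the
  intersection of the powers of \<open>J\<close> as an idempotent ideal; one-sided stability does not suffice here.
\<close>

lemma rad_inter_idempotent:
  assumes art: "right_\<Gamma>0_artinian \<Gamma> R S" "left_\<Gamma>0_artinian \<Gamma> R S"
  shows "rad_inter \<subseteq> ideal_prod R rad_inter rad_inter" (is "_ \<subseteq> ?KK")
proof (rule graded_subgroup_subset[OF right_gr_ideal_graded[OF rad_inter_ideal(1)]])
  show KK: "additive_subgroup ?KK R"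
    using right_gr_ideal_sub[OF rad_inter_ideal(1)] by (intro additive_subgroup_ideal_prod)
  fix \<gamma> x assume x: "\<gamma> \<in> carrier \<Gamma>" "x \<in> rad_inter" "x \<in> S \<gamma>"
  define e f where "e = gran \<Gamma> \<gamma>" and "f = gdom \<Gamma> \<gamma>"
  have ef: "e \<in> identities \<Gamma>" "f \<in> identities \<Gamma>"
    using x gran_identity gdom_identity by (auto simp: e_def f_def)
  note c = unit_carrier[OF ef(1)] unit_carrier[OF ef(2)]
  obtain n where n: "\<And>k. \<one>\<^sub>e <# rad_power n \<subseteq> rad_power k"
    using right_artinian_stable[where P = "\<lambda>n. rad_power n", OF art(1) ef(1) rad_power_ideal rad_power_decreasing] by blast
  obtain m where m: "\<And>k. rad_power m #> \<one>\<^sub>f \<subseteq> rad_power k"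
    using left_artinian_stable[where P = "\<lambda>n. rad_power n", OF art(2) ef(2) rad_power_ideal rad_power_decreasing] by blast
  note sub = right_gr_ideal_carrier[OF rad_power_ideal(1)]
  \<comment> \<open>The right-hand side collects the \<open>y\<close> for which
    \<open>\<one>\<^sub>e \<otimes> (y \<otimes> \<one>\<^sub>f)\<close> lies in the square of the
    intersection; on a product \<open>u \<otimes> v\<close> the two units attach to separate
    factors.\<close>
  have "ideal_prod R (rad_power n) (rad_power m) \<subseteq>
    {y \<in> carrier R. y \<otimes> \<one>\<^sub>f \<in> {z \<in> carrier R. \<one>\<^sub>e \<otimes> z \<in> ?KK}}"
  proof (rule ideal_prod_least)
    show "additive_subgroup {y \<in> carrier R. y \<otimes> \<one>\<^sub>f \<in> {z \<in> carrier R. \<one>\<^sub>e \<otimes> z \<in> ?KK}} R"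
      using c by (intro additive_subgroup_mult_right_vimage additive_subgroup_mult_left_vimage KK)
    fix u v assume uv: "u \<in> rad_power n" "v \<in> rad_power m"
    then have uvR: "u \<in> carrier R" "v \<in> carrier R" using sub by blast+
    have "\<one>\<^sub>e \<otimes> u \<in> rad_power k" "v \<otimes> \<one>\<^sub>f \<in> rad_power k" for k
      using n[of k] m[of k] uv by (auto simp: l_coset_eq_image r_coset_eq_image)
    then have "\<one>\<^sub>e \<otimes> u \<in> rad_inter" "v \<otimes> \<one>\<^sub>f \<in> rad_inter"
      by (simp_all add: rad_inter_def)
    then have "(\<one>\<^sub>e \<otimes> u) \<otimes> (v \<otimes> \<one>\<^sub>f) \<in> ?KK" by (rule ideal_prod.prod)
    moreover have "(\<one>\<^sub>e \<otimes> u) \<otimes> (v \<otimes> \<one>\<^sub>f) = \<one>\<^sub>e \<otimes> (u \<otimes> v \<otimes> \<one>\<^sub>f)"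
      using uvR c by (simp add: mult_closed mult_assoc)
    ultimately show "u \<otimes> v \<in> {y \<in> carrier R. y \<otimes> \<one>\<^sub>f \<in> {z \<in> carrier R. \<one>\<^sub>e \<otimes> z \<in> ?KK}}"
      using uvR c by (simp add: mult_closed)
  qed
  moreover have "x \<in> ideal_prod R (rad_power n) (rad_power m)"
    using x(2) rad_power_add_subset[of n m] unfolding rad_inter_def by blast
  ultimately have "\<one>\<^sub>e \<otimes> (x \<otimes> \<one>\<^sub>f) \<in> ?KK" by blast
  then show "x \<in> ?KK"
    using local_unit_left[OF x(1,3)] local_unit_right[OF x(1,3)] by (simp add: e_def f_def)
qed

lemma rad_inter_eq_zero:
  assumes art: "right_\<Gamma>0_artinian \<Gamma> R S" "left_\<Gamma>0_artinian \<Gamma> R S"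
  shows "rad_inter = {\<zero>}"
proof (rule idempotent_subset_rad_eq_zero[OF art(1) rad_inter_ideal rad_inter_idempotent[OF art]])
  show "rad_inter \<subseteq> rad" unfolding rad_inter_def using rad_power_0 by blast
qed

lemma rad_objectwise_nilpotent:
  assumes art: "right_\<Gamma>0_artinian \<Gamma> R S" "left_\<Gamma>0_artinian \<Gamma> R S"
  shows "objectwise_nilpotent \<Gamma> R S rad"
  unfolding objectwise_nilpotent_def
proof
  fix e assume e: "e \<in> identities \<Gamma>"
  obtain n where n: "\<And>k. \<one>\<^sub>e <# rad_power n \<subseteq> rad_power k"
    using right_artinian_stable[where P = "\<lambda>n. rad_power n", OF art(1) e rad_power_ideal rad_power_decreasing] by blast
  obtain m where m: "\<And>k. rad_power m #> \<one>\<^sub>e \<subseteq> rad_power k"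
    using left_artinian_stable[where P = "\<lambda>n. rad_power n", OF art(2) e rad_power_ideal rad_power_decreasing] by blast
  \<comment> \<open>A stable term lies in every power of the radical, hence in their intersection,
    which is zero.\<close>
  have "\<one>\<^sub>e <# rad_power n \<subseteq> {\<zero>}" "rad_power m #> \<one>\<^sub>e \<subseteq> {\<zero>}"
    using n m unfolding rad_inter_eq_zero[OF art, symmetric] rad_inter_def by blast+
  moreover have "\<zero> \<in> \<one>\<^sub>e <# rad_power n" "\<zero> \<in> rad_power m #> \<one>\<^sub>e"
    using right_gr_ideal_zero[OF rad_power_ideal(1)] unit_carrier[OF e]
    by (force simp: l_coset_eq_image r_coset_eq_image)+
  ultimately have "\<one>\<^sub>e <# rad_power n = {\<zero>}" "rad_power m #> \<one>\<^sub>e = {\<zero>}" by auto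
  \<comment> \<open>The exponents sought are \<open>Suc n\<close> and \<open>Suc m\<close>, by the
    shift in \<open>rad_power\<close>.\<close>
  then show "\<exists>n>0. \<exists>m>0. \<one>\<^sub>e <# ideal_power R rad n = {\<zero>} \<and> ideal_power R rad m #> \<one>\<^sub>e = {\<zero>}"
    by blast
qed

section \<open>Semisimplicity modulo the radical\<close>

text \<open>These are the preimages of the gr-simple right ideals of \<open>R / rad\<close>,
  described inside \<open>R\<close> itself.\<close>

definition gr_atom :: "'a set \<Rightarrow> bool" where
  "gr_atom T \<longleftrightarrow> right_gr_ideal T \<and> rad \<subset> T \<and>
    (\<forall>W. right_gr_ideal W \<and> rad \<subseteq> W \<and> W \<subseteq> T \<longrightarrow> W = rad \<or> W = T)"

text \<open>This is semisimplicity of \<open>R / rad\<close> phrased in \<open>R\<close>. Allowing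
  any additive subgroup \<open>D\<close> lets the lemma serve both for the quotient, with a preimage
  as \<open>D\<close>, and for finding maximal subideals.\<close>

lemma gr_atoms_generate:
  assumes art: "right_\<Gamma>0_artinian \<Gamma> R S" and D: "additive_subgroup D R"
    and rad: "rad \<subseteq> D" and atoms: "\<And>T. gr_atom T \<Longrightarrow> T \<subseteq> D"
  shows "carrier R \<subseteq> D"
proof (rule graded_subgroup_subset[OF graded_subgroup_carrier D])
  fix \<gamma> x assume x: "\<gamma> \<in> carrier \<Gamma>" "x \<in> carrier R" "x \<in> S \<gamma>"
  define e where "e = gran \<Gamma> \<gamma>"
  have e: "e \<in> identities \<Gamma>" using x gran_identity by (simp add: e_def)
  have "\<one>\<^sub>e <# carrier R \<subseteq> D"
  proof (rule ccontr)
    assume "\<not> \<one>\<^sub>e <# carrier R \<subseteq> D"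
    let ?\<A> = "{T. right_gr_ideal T \<and> T \<subseteq> \<one>\<^sub>e <# carrier R \<and> \<not> T \<subseteq> D}"
    have "\<one>\<^sub>e <# carrier R \<in> ?\<A>"
      using right_gr_ideal_unit[OF e] \<open>\<not> \<one>\<^sub>e <# carrier R \<subseteq> D\<close> by simp
    then have "?\<A> \<noteq> {}" by blast
    then have "\<exists>T\<in>?\<A>. \<forall>V\<in>?\<A>. V \<subseteq> T \<longrightarrow> V = T"
      by (rule right_artinian_minimal[OF art e]) blast
    then obtain T where T: "T \<in> ?\<A>" and Tmin: "\<forall>V\<in>?\<A>. V \<subseteq> T \<longrightarrow> V = T" ..
    have Tr: "right_gr_ideal T" using T by simp
    \<comment> \<open>Inside \<open>T\<close>, a right ideal minimal among those not contained in
      the radical yields an atom after adding the radical.\<close>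
    let ?\<B> = "{V. right_gr_ideal V \<and> V \<subseteq> T \<and> \<not> V \<subseteq> rad}"
    have "T \<in> ?\<B>" using T rad by blast
    then have "?\<B> \<noteq> {}" by blast
    then have "\<exists>V\<in>?\<B>. \<forall>W\<in>?\<B>. W \<subseteq> V \<longrightarrow> W = V"
      by (rule right_artinian_minimal[OF art e]) (use T in blast)
    then obtain V where V: "V \<in> ?\<B>" and Vmin: "\<forall>W\<in>?\<B>. W \<subseteq> V \<longrightarrow> W = V" ..
    have Vr: "right_gr_ideal V" using V by simp
    note radr = rad_right_gr_ideal
    note sup = set_add_superset[OF right_gr_ideal_sub[OF Vr] right_gr_ideal_sub[OF radr]]
    have "gr_atom (V <+> rad)"
      unfolding gr_atom_def
    proof (intro conjI allI impI)
      show "right_gr_ideal (V <+> rad)" by (rule right_gr_ideal_set_add[OF Vr radr])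
      show "rad \<subset> V <+> rad" using sup V by blast
      fix W assume W: "right_gr_ideal W \<and> rad \<subseteq> W \<and> W \<subseteq> V <+> rad"
      then have Wr: "right_gr_ideal W" by simp
      show "W = rad \<or> W = V <+> rad"
      \<comment> \<open>Minimality of \<open>V\<close> leaves two cases. If
        \<open>W \<inter> V\<close> lies in the radical, the modular law puts \<open>W\<close> there
        too; otherwise \<open>W\<close> contains \<open>V\<close>.\<close>
      proof (cases "W \<inter> V \<subseteq> rad")
        case True
        have "w \<in> rad" if w: "w \<in> W" for w
        proof -
          obtain v j where vj: "v \<in> V" "j \<in> rad" "w = v \<oplus> j"
            using subsetD[of W "V <+> rad" w] W w unfolding mem_set_add_iff by blast
          then have c: "v \<in> carrier R" "j \<in> carrier R"
            using right_gr_ideal_carrier Vr radr by blast+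
          then have "v = w \<oplus> \<ominus> j" using vj(3) by (simp add: a_assoc r_neg)
          also have "\<dots> \<in> W" using w vj(2) W right_gr_ideal_sub[OF Wr] by (auto simp: additive_subgroup_iff)
          finally have "v \<in> rad" using vj(1) True by blast
          then show ?thesis using vj right_gr_ideal_sub[OF radr] by (simp add: additive_subgroup_iff)
        qed
        then show ?thesis using W by blast
      next
        case False
        then have "W \<inter> V \<in> ?\<B>" using right_gr_ideal_Int[OF Wr Vr] V by blast
        then have "W \<inter> V = V" using Vmin by blast
        then have "V <+> rad \<subseteq> W" using W by (intro set_add_least right_gr_ideal_sub) auto
        then show ?thesis using W by blast
      qed
    qed
    then have VD: "V \<subseteq> D" using atoms sup by blast
    \<comment> \<open>Since \<open>V\<close> is not contained in the radical, some gr-maximal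
      \<open>M\<close> omits an element of \<open>V\<close>, and then \<open>V <+> M\<close> is all
      of \<open>R\<close>.\<close>
    obtain v M where M: "gr_maximal \<Gamma> R S M" "v \<in> V" "v \<notin> M"
      using V right_gr_ideal_carrier[OF Vr] by (auto simp: gr_radical_def)
    have Mr: "right_gr_ideal M" using M(1) by (rule gr_maximal_right_gr_ideal)
    note supM = set_add_superset[OF right_gr_ideal_sub[OF Vr] right_gr_ideal_sub[OF Mr]]
    have "V <+> M = M \<or> V <+> M = carrier R"
      using M(1) right_gr_ideal_set_add[OF Vr Mr] supM(2) unfolding gr_maximal_def by blast
    then have VM: "V <+> M = carrier R" using M supM(1) by blast
    have TM: "T \<inter> M \<subseteq> D"
    proof (rule ccontr)
      assume "\<not> T \<inter> M \<subseteq> D"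
      then have "T \<inter> M \<in> ?\<A>" using right_gr_ideal_Int[OF Tr Mr] T by blast
      then have "T \<inter> M = T" using Tmin by blast
      then show False using M V by blast
    qed
    \<comment> \<open>By the modular law \<open>T\<close> is the sum of \<open>V\<close> and
      \<open>T \<inter> M\<close>, both contained in \<open>D\<close>.\<close>
    have "t \<in> D" if t: "t \<in> T" for t
    proof -
      have "t \<in> V <+> M" using VM t right_gr_ideal_carrier[OF Tr] by blast
      then obtain w m where wm: "w \<in> V" "m \<in> M" "t = w \<oplus> m" by (auto simp: mem_set_add_iff)
      then have c: "w \<in> carrier R" "m \<in> carrier R"
        using right_gr_ideal_carrier Vr Mr by blast+
      then have "m = \<ominus> w \<oplus> t" using wm(3) by (simp add: l_neg flip: a_assoc)
      also have "\<dots> \<in> T" using t wm(1) V right_gr_ideal_sub[OF Tr] by (auto simp: additive_subgroup_iff)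
      finally have "m \<in> D" using wm TM by blast
      then show ?thesis using wm VD D by (auto simp: additive_subgroup_iff)
    qed
    then show False using T by blast
  qed
  then show "x \<in> D" using homogeneous_mem_unit[OF x(1,3)] by (auto simp: e_def)
qed

section \<open>Noetherianity\<close>

text \<open>Two elements of the union lie in a common member of the chain, which settles sums; every
  other closure property concerns a single element of the union.\<close>

lemma right_gr_ideal_Union_chain:
  assumes ne: "\<C> \<noteq> {}" and chain: "subset.chain \<A> \<C>" and ideals: "\<And>C. C \<in> \<C> \<Longrightarrow> right_gr_ideal C"
  shows "right_gr_ideal (\<Union>\<C>)"
proof -
  have "\<exists>C\<in>\<C>. x \<in> C \<and> y \<in> C" if xy: "x \<in> \<Union>\<C>" "y \<in> \<Union>\<C>" for x y
  proof -
    obtain C C' where "C \<in> \<C>" "x \<in> C" "C' \<in> \<C>" "y \<in> C'" using xy by blast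
    moreover from this have "C \<subseteq> C' \<or> C' \<subseteq> C" using chain by (auto simp: subset_chain_def)
    ultimately show ?thesis by blast
  qed
  then have add: "x \<oplus> y \<in> \<Union>\<C>" if "x \<in> \<Union>\<C>" "y \<in> \<Union>\<C>" for x y
    using that ideals right_gr_ideal_sub unfolding additive_subgroup_iff by (metis UnionI)
  have each: "x \<in> carrier R" "\<ominus> x \<in> \<Union>\<C>" "a \<in> carrier R \<Longrightarrow> x \<otimes> a \<in> \<Union>\<C>"
    "\<gamma> \<in> carrier \<Gamma> \<Longrightarrow> component x \<gamma> \<in> \<Union>\<C>" if x: "x \<in> \<Union>\<C>" for x a \<gamma>
  proof -
    obtain C where C: "C \<in> \<C>" "x \<in> C" using x by blast
    then have Cr: "right_gr_ideal C" using ideals by blast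
    show "x \<in> carrier R" using C right_gr_ideal_carrier[OF Cr] by blast
    have "\<ominus> x \<in> C" using C right_gr_ideal_sub[OF Cr] by (simp add: additive_subgroup_iff)
    then show "\<ominus> x \<in> \<Union>\<C>" using C by blast
    show "x \<otimes> a \<in> \<Union>\<C>" if "a \<in> carrier R" using C right_gr_ideal_mult[OF Cr] that by blast
    show "component x \<gamma> \<in> \<Union>\<C>" if "\<gamma> \<in> carrier \<Gamma>"
    proof -
      have "component x \<gamma> \<in> C" using C that right_gr_ideal_graded[OF Cr] by (simp add: graded_subgroup_def)
      then show ?thesis using C by blast
    qed
  qed
  obtain C0 where "C0 \<in> \<C>" using ne by blast
  then have "\<zero> \<in> \<Union>\<C>" using right_gr_ideal_zero[OF ideals] by blast
  then show ?thesis
    unfolding right_gr_ideal_iff graded_subgroup_def additive_subgroup_iff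
    using add each by blast
qed

text \<open>
  Since \<open>B J \<noteq> B\<close>, there is a homogeneous \<open>b\<close> in \<open>B\<close> outside \<open>B J\<close>. A right ideal \<open>C\<close> between \<open>B J\<close>
  and \<open>B\<close> that is maximal with respect to \<open>b \<notin> C\<close> is then maximal in \<open>B\<close>: the quotient \<open>B / C\<close> is
  semisimple and has the image of \<open>C + b R\<close> as its only simple submodule.
\<close>

lemma ex_maximal_right_gr_subideal:
  assumes art: "right_\<Gamma>0_artinian \<Gamma> R S" and B: "right_gr_ideal B"
    and BJ: "\<not> B \<subseteq> ideal_prod R B rad"
  shows "\<exists>C. right_gr_ideal C \<and> C \<subset> B \<and>
    (\<forall>E. right_gr_ideal E \<and> C \<subseteq> E \<and> E \<subseteq> B \<longrightarrow> E = C \<or> E = B)"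
proof -
  let ?N = "ideal_prod R B rad"
  have Nr: "right_gr_ideal ?N"
    by (rule right_gr_ideal_ideal_prod[OF right_gr_ideal_graded[OF B] rad_right_gr_ideal])
  have NB: "?N \<subseteq> B"
    by (rule ideal_prod_least[OF right_gr_ideal_sub[OF B]])
      (use right_gr_ideal_mult[OF B] right_gr_ideal_carrier[OF rad_right_gr_ideal] in blast)
  obtain \<beta> b where b: "\<beta> \<in> carrier \<Gamma>" "b \<in> B" "b \<in> S \<beta>" "b \<notin> ?N"
    using not_subset_homogeneous[OF right_gr_ideal_graded[OF B] right_gr_ideal_sub[OF Nr] BJ] by blast
  let ?\<A> = "{C. right_gr_ideal C \<and> ?N \<subseteq> C \<and> C \<subseteq> B \<and> b \<notin> C}"
  have "\<exists>C\<in>?\<A>. \<forall>X\<in>?\<A>. C \<subseteq> X \<longrightarrow> X = C"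
  proof (rule subset_Zorn_nonempty)
    show "?\<A> \<noteq> {}" using Nr NB b(4) by blast
    fix \<C> assume \<C>: "\<C> \<noteq> {}" "subset.chain ?\<A> \<C>"
    then have sub: "\<C> \<subseteq> ?\<A>" by (auto simp: subset_chain_def)
    then have "right_gr_ideal (\<Union>\<C>)" using \<C> by (intro right_gr_ideal_Union_chain) auto
    then show "\<Union>\<C> \<in> ?\<A>" using sub \<C>(1) by blast
  qed
  then obtain C where C: "C \<in> ?\<A>" and Cmax: "\<forall>X\<in>?\<A>. C \<subseteq> X \<longrightarrow> X = C" ..
  have Cr: "right_gr_ideal C" using C by simp
  have Pr: "right_gr_ideal (b <# carrier R)" by (rule right_gr_ideal_principal[OF b(1,3)])
  let ?D = "C <+> (b <# carrier R)"
  have Dr: "right_gr_ideal ?D" by (rule right_gr_ideal_set_add[OF Cr Pr])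
  have CD: "C \<subseteq> ?D" by (rule set_add_superset(1)[OF right_gr_ideal_sub[OF Cr] right_gr_ideal_sub[OF Pr]])
  \<comment> \<open>By maximality of \<open>C\<close>, every larger right ideal within
    \<open>B\<close> contains \<open>b\<close> and hence \<open>?D\<close>. So \<open>C\<close> is
    maximal in \<open>B\<close> once \<open>B\<close> is shown to lie in \<open>?D\<close>.\<close>
  have above: "b \<in> E" "?D \<subseteq> E" if E: "right_gr_ideal E" "C \<subseteq> E" "E \<subseteq> B" "E \<noteq> C" for E
  proof -
    show "b \<in> E"
    proof (rule ccontr)
      assume "b \<notin> E"
      then have "E \<in> ?\<A>" using E C by blast
      then show False using Cmax E by blast
    qed
    then have "b <# carrier R \<subseteq> E" using E principal_least by blast
    then show "?D \<subseteq> E" using E by (intro set_add_least right_gr_ideal_sub) auto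
  qed
  have "B \<subseteq> ?D"
  proof (rule graded_subgroup_subset[OF right_gr_ideal_graded[OF B] right_gr_ideal_sub[OF Dr]])
    fix \<gamma> x assume x: "\<gamma> \<in> carrier \<Gamma>" "x \<in> B" "x \<in> S \<gamma>"
    have xR: "x \<in> carrier R" using x S_carrier by blast
    let ?V = "{y \<in> carrier R. x \<otimes> y \<in> ?D}"
    have Vr: "right_gr_ideal ?V" by (rule right_gr_ideal_mult_left_vimage[OF x(1,3) Dr])
    have xrad: "x \<otimes> j \<in> C" if "j \<in> rad" for j
      using ideal_prod.prod[OF x(2) that, of R] C by blast
    have radc: "rad \<subseteq> carrier R" by (rule right_gr_ideal_carrier[OF rad_right_gr_ideal])
    \<comment> \<open>To get \<open>x\<close> into \<open>?D\<close>, all of \<open>R\<close> is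
      multiplied into \<open>?D\<close> by \<open>x\<close>; it is enough to do so for the radical,
      where the products already lie in \<open>C\<close>, and for each atom.\<close>
    have "carrier R \<subseteq> ?V"
    proof (rule gr_atoms_generate[OF art right_gr_ideal_sub[OF Vr]])
      show radV: "rad \<subseteq> ?V" using xrad CD radc by blast
      fix T assume T: "gr_atom T"
      then have Tr: "right_gr_ideal T" by (simp add: gr_atom_def)
      have Tc: "T \<subseteq> carrier R" by (rule right_gr_ideal_carrier[OF Tr])
      have xT: "right_gr_ideal (x <# T)" by (rule right_gr_ideal_mult_left_image[OF x(1,3) Tr])
      let ?E = "C <+> (x <# T)"
      have Er: "right_gr_ideal ?E" by (rule right_gr_ideal_set_add[OF Cr xT])
      note supE = set_add_superset[OF right_gr_ideal_sub[OF Cr] right_gr_ideal_sub[OF xT]]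
      have "x <# T \<subseteq> B" using right_gr_ideal_mult[OF B x(2)] Tc by (auto simp: l_coset_eq_image)
      then have EB: "?E \<subseteq> B" using C by (intro set_add_least right_gr_ideal_sub[OF B]) auto
      show "T \<subseteq> ?V"
      proof (cases "x <# T \<subseteq> C")
        case True
        then show ?thesis using CD Tc by (auto simp: l_coset_eq_image)
      next
        case False
        then have "?E \<noteq> C" using supE by blast
        then have "b \<in> ?E" using above(1)[OF Er supE(1) EB] by blast
        then obtain c t where ct: "c \<in> C" "t \<in> T" "b = c \<oplus> x \<otimes> t"
          by (auto simp: mem_set_add_iff l_coset_eq_image)
        have c: "c \<in> carrier R" "t \<in> carrier R"
          using ct right_gr_ideal_carrier[OF Cr] Tc by blast+
        have "b \<in> ?D"
          using homogeneous_mem_principal[OF b(1,3)]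
            set_add_superset(2)[OF right_gr_ideal_sub[OF Cr] right_gr_ideal_sub[OF Pr]] by blast
        moreover have "x \<otimes> t = \<ominus> c \<oplus> b"
          using ct(3) c xR by (simp add: mult_closed l_neg flip: a_assoc)
        ultimately have xt: "x \<otimes> t \<in> ?D"
          using ct(1) CD right_gr_ideal_sub[OF Dr] by (auto simp: additive_subgroup_iff)
        \<comment> \<open>The atom \<open>T\<close> leaves only two values. The first is excluded by
          \<open>t\<close>: were it in the radical, \<open>x \<otimes> t\<close> and with it
          \<open>b\<close> would lie in \<open>C\<close>.\<close>
        have "T \<inter> ?V = rad \<or> T \<inter> ?V = T"
          using T right_gr_ideal_Int[OF Tr Vr] radV unfolding gr_atom_def by blast
        moreover have "T \<inter> ?V \<noteq> rad"
        proof
          assume "T \<inter> ?V = rad"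
          then have "x \<otimes> t \<in> C" using xrad xt ct(2) c(2) by blast
          then have "b \<in> C" using ct(1,3) right_gr_ideal_sub[OF Cr] by (simp add: additive_subgroup_iff)
          then show False using C by blast
        qed
        ultimately show ?thesis by blast
      qed
    qed
    then have "\<one>\<^sub>(gdom \<Gamma> \<gamma>) \<in> ?V" using unit_carrier[OF gdom_identity[OF x(1)]] by blast
    then show "x \<in> ?D" using local_unit_right[OF x(1,3)] by simp
  qed
  then have "E = C \<or> E = B" if "right_gr_ideal E \<and> C \<subseteq> E \<and> E \<subseteq> B" for E
    using above(2)[of E] that by blast
  moreover have "C \<subset> B" using C b(2) by blast
  ultimately show ?thesis using Cr by blast
qed

lemma right_noetherian:
  assumes art: "right_\<Gamma>0_artinian \<Gamma> R S" "left_\<Gamma>0_artinian \<Gamma> R S"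
  shows "right_\<Gamma>0_noetherian \<Gamma> R S"
  unfolding right_\<Gamma>0_noetherian_def
proof
  fix e assume e: "e \<in> identities \<Gamma>"
  let ?P = "\<one>\<^sub>e <# carrier R"
  \<comment> \<open>The chains ascend weakly, so that being stationary is a meaningful requirement
    and sums and intersections with \<open>B\<close> give chains again.\<close>
  define ascending where "ascending B U \<longleftrightarrow>
    (\<forall>n. right_gr_ideal (U n) \<and> B \<subseteq> U n \<and> U n \<subseteq> ?P \<and> U n \<subseteq> U (Suc n))" for B and U :: "nat \<Rightarrow> 'a set"
  let ?\<A> = "{B. right_gr_ideal B \<and> B \<subseteq> ?P \<and> (\<forall>U. ascending B U \<longrightarrow> (\<exists>n. \<forall>m\<ge>n. U m = U n))}"
  have "?P \<in> ?\<A>"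
  proof -
    have "\<exists>n. \<forall>m\<ge>n. U m = U n" if "ascending ?P U" for U
    proof -
      have "U m = ?P" for m using that unfolding ascending_def by blast
      then show ?thesis by simp
    qed
    then show ?thesis using right_gr_ideal_unit[OF e] by blast
  qed
  then have "?\<A> \<noteq> {}" by blast
  then have "\<exists>B\<in>?\<A>. \<forall>C\<in>?\<A>. C \<subseteq> B \<longrightarrow> C = B"
    by (rule right_artinian_minimal[OF art(1) e]) blast
  then obtain B where B: "B \<in> ?\<A>" and Bmin: "\<forall>C\<in>?\<A>. C \<subseteq> B \<longrightarrow> C = B" ..
  have Br: "right_gr_ideal B" and BP: "B \<subseteq> ?P"
    and Bstable: "\<And>U. ascending B U \<Longrightarrow> \<exists>n. \<forall>m\<ge>n. U m = U n"
    using B by blast+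
  have "B \<subseteq> ideal_prod R B rad"
  proof (rule ccontr)
    assume "\<not> B \<subseteq> ideal_prod R B rad"
    \<comment> \<open>\<open>C\<close> is properly below \<open>B\<close> with nothing in between;
      chains above \<open>C\<close> will turn out stationary too, against the minimality of
      \<open>B\<close>.\<close>
    from ex_maximal_right_gr_subideal[OF art(1) Br this]
    obtain C where max: "right_gr_ideal C \<and> C \<subset> B \<and>
      (\<forall>E. right_gr_ideal E \<and> C \<subseteq> E \<and> E \<subseteq> B \<longrightarrow> E = C \<or> E = B)" ..
    then have C: "right_gr_ideal C" "C \<subset> B" by simp_all
    have cover: "E = C \<or> E = B" if "right_gr_ideal E" "C \<subseteq> E" "E \<subseteq> B" for E
      using max that by simp
    have "\<exists>n. \<forall>m\<ge>n. U m = U n" if "ascending C U" for U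
    proof -
      have Ur: "right_gr_ideal (U n)" and CU: "C \<subseteq> U n" and UP: "U n \<subseteq> ?P" and step: "U n \<subseteq> U (Suc n)" for n
        using that by (auto simp: ascending_def)
      have mono: "U n \<subseteq> U m" if "n \<le> m" for n m
        using lift_Suc_mono_le[of U, OF step that] .
      have subs: "additive_subgroup (U n) R" "additive_subgroup B R" for n
        using Ur Br right_gr_ideal_sub by auto
      have "ascending B (\<lambda>n. U n <+> B)"
        unfolding ascending_def
      proof (intro allI conjI)
        fix n
        show "right_gr_ideal (U n <+> B)" by (rule right_gr_ideal_set_add[OF Ur Br])
        show "B \<subseteq> U n <+> B" by (rule set_add_superset(2)[OF subs])
        show "U n <+> B \<subseteq> ?P"
          by (rule set_add_least[OF right_gr_ideal_sub[OF right_gr_ideal_unit[OF e]] UP BP])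
        show "U n <+> B \<subseteq> U (Suc n) <+> B"
          by (rule set_add_least[OF add_additive_subgroups[OF subs]])
            (use step[of n] set_add_superset[OF subs, of "Suc n"] in auto)
      qed
      then obtain n1 where n1: "\<And>m. m \<ge> n1 \<Longrightarrow> U m <+> B = U n1 <+> B" using Bstable by blast
      have cases: "U n \<inter> B = C \<or> U n \<inter> B = B" for n
        using cover[OF right_gr_ideal_Int[OF Ur Br]] CU C(2) by blast
      \<comment> \<open>The increasing sequence \<open>U n \<inter> B\<close> takes only the values
        \<open>C\<close> and \<open>B\<close>, so it changes at most once.\<close>
      obtain n2 where n2: "\<And>m. m \<ge> n2 \<Longrightarrow> U m \<inter> B = U n2 \<inter> B"
      proof (cases "\<forall>n. U n \<inter> B = C")
        case True
        then show ?thesis using that by blast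
      next
        case False
        then obtain n where n: "U n \<inter> B = B" using cases by blast
        then have "U m \<inter> B = U n \<inter> B" if "m \<ge> n" for m using mono[OF that] by blast
        then show ?thesis by (rule that)
      qed
      define n where "n = max n1 n2"
      \<comment> \<open>Modular law: past \<open>n\<close>, the sums with \<open>B\<close> and the
        intersections with \<open>B\<close> are constant, which forces the nested \<open>U n\<close>
        and \<open>U m\<close> to agree.\<close>
      have "U m = U n" if m: "m \<ge> n" for m
      proof
        show "U n \<subseteq> U m" by (rule mono[OF m])
        show "U m \<subseteq> U n"
        proof
          fix x assume x: "x \<in> U m"
          have "U m <+> B = U n <+> B" using n1[of m] n1[of n] m by (simp add: n_def)
          then have "x \<in> U n <+> B" using x set_add_superset(1)[OF subs, of m] by auto
          then obtain u b where ub: "u \<in> U n" "b \<in> B" "x = u \<oplus> b" by (auto simp: mem_set_add_iff)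
          then have c: "u \<in> carrier R" "b \<in> carrier R"
            using right_gr_ideal_carrier Ur Br by blast+
          then have "b = \<ominus> u \<oplus> x" using ub(3) by (simp add: l_neg flip: a_assoc)
          also have "\<dots> \<in> U m"
            using x ub(1) mono[OF m] subs(1)[of m] by (auto simp: additive_subgroup_iff)
          finally have "b \<in> U m \<inter> B" using ub(2) by simp
          also have "U m \<inter> B = U n \<inter> B" using n2[of m] n2[of n] m by (simp add: n_def)
          finally show "x \<in> U n" using ub subs(1)[of n] by (simp add: additive_subgroup_iff)
        qed
      qed
      then show ?thesis by blast
    qed
    then have "C \<in> ?\<A>" using C BP by blast
    then show False using Bmin C(2) by blast
  qed
  then have BBJ: "B \<subseteq> ideal_prod R B rad" .
  \<comment> \<open>Feeding the inclusion of \<open>B\<close> in \<open>B rad\<close> into itself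
    raises the exponent by one each time.\<close>
  have "B \<subseteq> rad_power n" for n
  proof (induction n)
    case 0
    have "ideal_prod R B rad \<subseteq> rad"
      by (rule ideal_prod_least[OF right_gr_ideal_sub[OF rad_right_gr_ideal]])
        (use rad_left_gr_ideal right_gr_ideal_carrier[OF Br] in \<open>auto simp: left_gr_ideal_iff\<close>)
    with BBJ show ?case unfolding rad_power_0 by (rule subset_trans)
  next
    case (Suc n)
    have "ideal_prod R B rad \<subseteq> rad_power (Suc n)"
      unfolding rad_power_Suc by (rule ideal_prod_mono[OF Suc.IH subset_refl])
    with BBJ show ?case by (rule subset_trans)
  qed
  then have "B \<subseteq> {\<zero>}"
    unfolding rad_inter_eq_zero[OF art, symmetric] rad_inter_def by blast
  show "\<not> (\<exists>U. \<forall>n. right_gr_ideal (U n) \<and> U n \<subseteq> ?P \<and> U n \<subset> U (Suc n))"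
  proof
    assume "\<exists>U. \<forall>n. right_gr_ideal (U n) \<and> U n \<subseteq> ?P \<and> U n \<subset> U (Suc n)"
    then obtain U where U: "\<And>n. right_gr_ideal (U n)" "\<And>n. U n \<subseteq> ?P" "\<And>n. U n \<subset> U (Suc n)" by blast
    \<comment> \<open>With \<open>B\<close> zero, stationarity above \<open>B\<close> covers every
      ascending chain, and a strictly ascending one is impossible.\<close>
    have "B \<subseteq> U n" for n using \<open>B \<subseteq> {\<zero>}\<close> right_gr_ideal_zero[OF U(1)] by blast
    then have "ascending B U" using U unfolding ascending_def by blast
    from Bstable[OF this] obtain n where n: "\<forall>m\<ge>n. U m = U n" ..
    have "U (Suc n) = U n" by (rule n[rule_format]) simp
    then show False using U(3)[of n] by simp
  qed
qed

section \<open>The quotient by the radical\<close>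

abbreviation quot_map :: "'a set \<Rightarrow> 'a \<Rightarrow> 'a set"
  where "quot_map J a \<equiv> J +> a"

lemma quot_facts:
  assumes Jr: "right_gr_ideal J" and Jl: "graded_left_ideal \<Gamma> R S J"
  shows quot_carrier: "carrier (R Quot J) = quot_map J ` carrier R"
    and quot_zero: "\<zero>\<^bsub>R Quot J\<^esub> = J"
    and quot_eq_zero_iff: "a \<in> carrier R \<Longrightarrow> quot_map J a = J \<longleftrightarrow> a \<in> J"
    and quot_hom: "quot_map J \<in> hom (add_monoid R) (add_monoid (R Quot J))"
    and quot_mult: "a \<in> carrier R \<Longrightarrow> b \<in> carrier R \<Longrightarrow>
      quot_map J a \<otimes>\<^bsub>R Quot J\<^esub> quot_map J b = quot_map J (a \<otimes> b)"
proof -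
  interpret J: abelian_subgroup J R
    by (rule abelian_subgroupI3[OF right_gr_ideal_sub[OF Jr] abelian_group_axioms])
  show car: "carrier (R Quot J) = quot_map J ` carrier R"
    by (auto simp: FactRing_def A_RCOSETS_def RCOSETS_def a_r_coset_def)
  show "\<zero>\<^bsub>R Quot J\<^esub> = J" by (simp add: FactRing_def)
  show "quot_map J a = J \<longleftrightarrow> a \<in> J" if "a \<in> carrier R"
    using a_coset_join1[OF _ that J.a_subgroup] a_coset_join2[OF that J.a_subgroup] by blast
  show "quot_map J \<in> hom (add_monoid R) (add_monoid (R Quot J))"
    using J.a_rcos_sum unfolding hom_def by (simp add: car) (simp add: FactRing_def)
  have mem: "x \<in> quot_map J a \<longleftrightarrow> (\<exists>h\<in>J. x = h \<oplus> a)" for x a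
    by (auto simp: a_r_coset_def r_coset_def)
  fix a b assume ab: "a \<in> carrier R" "b \<in> carrier R"
  \<comment> \<open>The product of cosets is a union over all representatives; two-sidedness of
    \<open>J\<close> makes every member of that union the same coset.\<close>
  have "quot_map J (x \<otimes> y) = quot_map J (a \<otimes> b)" if x: "x \<in> quot_map J a" and y: "y \<in> quot_map J b" for x y
  proof -
    obtain h where h: "h \<in> J" "x = h \<oplus> a" using x mem by blast
    obtain k where k: "k \<in> J" "y = k \<oplus> b" using y mem by blast
    have c: "h \<in> carrier R" "k \<in> carrier R" using h(1) k(1) J.a_subset by blast+
    have "h \<otimes> (k \<oplus> b) \<oplus> a \<otimes> k \<in> J"
    proof (rule J.a_closed)
      show "h \<otimes> (k \<oplus> b) \<in> J" using right_gr_ideal_mult[OF Jr h(1)] c ab by simp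
      show "a \<otimes> k \<in> J" using Jl k(1) ab by (simp add: left_gr_ideal_iff)
    qed
    moreover have "x \<otimes> y = h \<otimes> (k \<oplus> b) \<oplus> a \<otimes> k \<oplus> a \<otimes> b"
      using h(2) k(2) c ab by (simp add: left_distrib right_distrib mult_closed a_ac)
    ultimately have "x \<otimes> y \<in> quot_map J (a \<otimes> b)" using mem by blast
    then show ?thesis
      using a_repr_independence[OF _ _ J.a_subgroup] ab mult_closed by metis
  qed
  moreover have "a \<in> quot_map J a" "b \<in> quot_map J b" using ab J.a_rcos_self by auto
  moreover have "quot_map J a \<otimes>\<^bsub>R Quot J\<^esub> quot_map J b
    = (\<Union>x\<in>quot_map J a. \<Union>y\<in>quot_map J b. quot_map J (x \<otimes> y))"
    by (simp add: FactRing_def rcoset_mult_def)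
  ultimately show "quot_map J a \<otimes>\<^bsub>R Quot J\<^esub> quot_map J b = quot_map J (a \<otimes> b)" by blast
qed

lemma quotient_struct:
  assumes "right_gr_ideal J" "graded_left_ideal \<Gamma> R S J"
  shows "graded_ring_struct \<Gamma> (R Quot J) (quotient_grading R S J)"
  using quotient_graded_ring[OF assms] by (simp add: graded_ring_struct_def)

lemma quotient_image_ideal:
  assumes Jr: "right_gr_ideal J" and Jl: "graded_left_ideal \<Gamma> R S J" and T: "right_gr_ideal T"
  shows "graded_right_ideal \<Gamma> (R Quot J) (quotient_grading R S J) (quot_map J ` T)"
proof -
  interpret Q: graded_ring_struct \<Gamma> "R Quot J" "quotient_grading R S J"
    by (rule quotient_struct[OF Jr Jl])
  note hom = quot_hom[OF Jr Jl]
  have "Q.graded_subgroup (quot_map J ` T)"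
  proof (rule Q.graded_subgroupI)
    show "additive_subgroup (quot_map J ` T) (R Quot J)"
      by (rule additive_subgroup_image[OF Q.abelian_group_axioms hom right_gr_ideal_sub[OF T]])
    fix V assume V: "additive_subgroup V (R Quot J)"
      and *: "\<And>\<gamma> X. \<gamma> \<in> carrier \<Gamma> \<Longrightarrow> X \<in> quot_map J ` T \<Longrightarrow> X \<in> quotient_grading R S J \<gamma> \<Longrightarrow> X \<in> V"
    have "T \<subseteq> {x \<in> carrier R. quot_map J x \<in> V}"
    proof (rule graded_subgroup_subset[OF right_gr_ideal_graded[OF T]
          additive_subgroup_vimage[OF Q.abelian_group_axioms hom V]])
      fix \<gamma> x assume x: "\<gamma> \<in> carrier \<Gamma>" "x \<in> T" "x \<in> S \<gamma>"
      then have "quot_map J x \<in> V" by (intro *) (auto simp: quotient_grading_def)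
      then show "x \<in> {x \<in> carrier R. quot_map J x \<in> V}" using x S_carrier by blast
    qed
    then show "quot_map J ` T \<subseteq> V" by blast
  qed
  moreover have "quot_map J t \<otimes>\<^bsub>R Quot J\<^esub> X \<in> quot_map J ` T" if t: "t \<in> T" and X: "X \<in> carrier (R Quot J)" for t X
  proof -
    obtain a where a: "a \<in> carrier R" "X = quot_map J a" using X quot_carrier[OF Jr Jl] by blast
    then show ?thesis
      using quot_mult[OF Jr Jl _ a(1), of t] t right_gr_ideal_carrier[OF T] right_gr_ideal_mult[OF T t a(1)]
      by auto
  qed
  ultimately show ?thesis unfolding Q.right_gr_ideal_iff by blast
qed

lemma quotient_vimage_ideal:
  assumes Jr: "right_gr_ideal J" and Jl: "graded_left_ideal \<Gamma> R S J"
    and W: "graded_right_ideal \<Gamma> (R Quot J) (quotient_grading R S J) W"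
  shows "right_gr_ideal {x \<in> carrier R. quot_map J x \<in> W}" (is "right_gr_ideal ?V")
proof -
  interpret Q: graded_ring_struct \<Gamma> "R Quot J" "quotient_grading R S J"
    by (rule quotient_struct[OF Jr Jl])
  note hom = quot_hom[OF Jr Jl]
  have qc: "quot_map J x \<in> carrier (R Quot J)" if "x \<in> carrier R" for x
    using quot_carrier[OF Jr Jl] that by blast
  \<comment> \<open>Taking components commutes with the quotient map: both composites are additive
    in \<open>x\<close> and agree on homogeneous elements.\<close>
  have comp: "Q.component (quot_map J x) \<gamma> = quot_map J (component x \<gamma>)"
    if \<gamma>: "\<gamma> \<in> carrier \<Gamma>" and xc: "x \<in> carrier R" for x \<gamma>
  proof -
    have f: "(\<lambda>x. Q.component (quot_map J x) \<gamma>) \<in> hom (add_monoid R) (add_monoid (R Quot J))"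
      using Group.hom_compose[OF hom Q.component_hom[OF \<gamma>]] by (simp add: comp_def)
    have g: "(\<lambda>x. quot_map J (component x \<gamma>)) \<in> hom (add_monoid R) (add_monoid (R Quot J))"
      using Group.hom_compose[OF component_hom[OF \<gamma>] hom] by (simp add: comp_def)
    have "carrier R \<subseteq> {x \<in> carrier R. Q.component (quot_map J x) \<gamma> = quot_map J (component x \<gamma>)}"
    proof (rule graded_subgroup_subset[OF graded_subgroup_carrier
          additive_subgroup_equalizer[OF Q.abelian_group_axioms f g]])
      fix \<delta> x assume x: "\<delta> \<in> carrier \<Gamma>" "x \<in> carrier R" "x \<in> S \<delta>"
      then have "quot_map J x \<in> quotient_grading R S J \<delta>" by (simp add: quotient_grading_def)
      then have "Q.component (quot_map J x) \<gamma> = quot_map J (component x \<gamma>)"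
        using x hom_zero_minus(1)[OF Q.abelian_group_axioms hom]
        by (simp add: component_homogeneous Q.component_homogeneous)
      then show "x \<in> {x \<in> carrier R. Q.component (quot_map J x) \<gamma> = quot_map J (component x \<gamma>)}"
        using x by simp
    qed
    then show ?thesis using xc by blast
  qed
  have Wg: "\<And>X \<gamma>. X \<in> W \<Longrightarrow> \<gamma> \<in> carrier \<Gamma> \<Longrightarrow> Q.component X \<gamma> \<in> W"
    using Q.right_gr_ideal_graded[OF W] by (simp add: Q.graded_subgroup_def)
  have "graded_subgroup ?V"
    unfolding graded_subgroup_def
  proof (intro conjI ballI)
    show "additive_subgroup ?V R"
      by (rule additive_subgroup_vimage[OF Q.abelian_group_axioms hom Q.right_gr_ideal_sub[OF W]])
    fix x \<gamma> assume "x \<in> ?V" "\<gamma> \<in> carrier \<Gamma>"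
    then show "component x \<gamma> \<in> ?V"
      using comp[of \<gamma> x] Wg[of "quot_map J x" \<gamma>] component_carrier by simp
  qed
  moreover have "u \<otimes> a \<in> ?V" if "u \<in> ?V" "a \<in> carrier R" for u a
    using that Q.right_gr_ideal_mult[OF W _ qc, of "quot_map J u" a] quot_mult[OF Jr Jl, of u a]
    by (simp add: mult_closed)
  ultimately show ?thesis unfolding right_gr_ideal_iff by blast
qed

text \<open>Correspondence of ideals: the preimage of a graded right ideal inside the image of
  \<open>T\<close> lies between the radical and \<open>T\<close>, so it is one of the two.\<close>

lemma gr_atom_quotient_simple:
  assumes T: "gr_atom T"
  shows "gr_simple \<Gamma> (R Quot rad) (quotient_grading R S rad) (quot_map rad ` T)"
proof -
  note J = rad_right_gr_ideal rad_left_gr_ideal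
  interpret Q: graded_ring_struct \<Gamma> "R Quot rad" "quotient_grading R S rad"
    by (rule quotient_struct[OF J])
  have Tr: "right_gr_ideal T" and radT: "rad \<subset> T"
    and atom: "\<And>W. right_gr_ideal W \<Longrightarrow> rad \<subseteq> W \<Longrightarrow> W \<subseteq> T \<Longrightarrow> W = rad \<or> W = T"
    using T by (auto simp: gr_atom_def)
  have Tc: "T \<subseteq> carrier R" by (rule right_gr_ideal_carrier[OF Tr])
  have radc: "rad \<subseteq> carrier R" by (rule right_gr_ideal_carrier[OF J(1)])
  show ?thesis
    unfolding gr_simple_def quot_zero[OF J]
  proof (intro conjI allI impI)
    show "Q.right_gr_ideal (quot_map rad ` T)" by (rule quotient_image_ideal[OF J Tr])
    obtain t where "t \<in> T" "t \<notin> rad" using radT by blast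
    then have "quot_map rad t \<noteq> rad" using quot_eq_zero_iff[OF J] Tc by blast
    then show "quot_map rad ` T \<noteq> {rad}" using \<open>t \<in> T\<close> by blast
    fix W assume W: "Q.right_gr_ideal W \<and> W \<subseteq> quot_map rad ` T"
    let ?V = "{x \<in> carrier R. quot_map rad x \<in> W}"
    have radW: "rad \<in> W" using Q.right_gr_ideal_zero[of W] W quot_zero[OF J] by simp
    have "quot_map rad x = rad" if "x \<in> rad" for x
      using quot_eq_zero_iff[OF J, of x] that radc by blast
    then have radV: "rad \<subseteq> ?V" using radc radW by auto
    \<comment> \<open>An element with the same coset as some \<open>t\<close> in \<open>T\<close>
      differs from it by an element of the radical, which is contained in \<open>T\<close>.\<close>
    have VT: "?V \<subseteq> T"
    proof
      fix x assume x: "x \<in> ?V"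
      then obtain t where t: "t \<in> T" "quot_map rad x = quot_map rad t" using W by blast
      have "x \<in> quot_map rad x"
        using abelian_subgroup.a_rcos_self[OF abelian_subgroupI3[OF right_gr_ideal_sub[OF J(1)] abelian_group_axioms]] x
        by blast
      then obtain j where "j \<in> rad" "x = j \<oplus> t" using t(2) by (auto simp: a_r_coset_def r_coset_def)
      then show "x \<in> T" using t(1) radT right_gr_ideal_sub[OF Tr] by (auto simp: additive_subgroup_iff)
    qed
    have WV: "W = quot_map rad ` ?V"
      using Q.right_gr_ideal_carrier[of W] W quot_carrier[OF J] by auto
    have "?V = rad \<or> ?V = T"
      using atom[OF quotient_vimage_ideal[OF J] radV VT] W by blast
    then show "W = {rad} \<or> W = quot_map rad ` T"
    proof
      assume V: "?V = rad"
      have "X = rad" if "X \<in> W" for X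
      proof -
        have "X \<in> quot_map rad ` rad" using that WV V by simp
        then show ?thesis using quot_eq_zero_iff[OF J] radc by blast
      qed
      then show ?thesis using radW by blast
    next
      assume "?V = T"
      then show ?thesis using WV by simp
    qed
  qed
qed

lemma quotient_gr_semisimple:
  assumes art: "right_\<Gamma>0_artinian \<Gamma> R S"
  shows "gr_semisimple \<Gamma> (R Quot rad) (quotient_grading R S rad)"
proof -
  note J = rad_right_gr_ideal rad_left_gr_ideal
  interpret Q: graded_ring_struct \<Gamma> "R Quot rad" "quotient_grading R S rad"
    by (rule quotient_struct[OF J])
  let ?\<V> = "(\<lambda>T. quot_map rad ` T) ` {T. gr_atom T}"
  have simple: "gr_simple \<Gamma> (R Quot rad) (quotient_grading R S rad) V" if "V \<in> ?\<V>" for V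
    using that gr_atom_quotient_simple by blast
  have sub: "additive_subgroup V (R Quot rad)" if "V \<in> ?\<V>" for V
    using simple[OF that] Q.right_gr_ideal_sub by (simp add: gr_simple_def)
  let ?F = "family_sum (R Quot rad) ?\<V> (\<lambda>V. V)"
  have F: "additive_subgroup ?F (R Quot rad)"
    by (rule Q.additive_subgroup_family_sum) (rule sub)
  \<comment> \<open>The preimage of the sum of the simple ideals is a subgroup containing the
    radical and every atom, hence all of \<open>R\<close>.\<close>
  have "carrier R \<subseteq> {x \<in> carrier R. quot_map rad x \<in> ?F}"
  proof (rule gr_atoms_generate[OF art additive_subgroup_vimage[OF Q.abelian_group_axioms quot_hom[OF J] F]])
    have zero: "quot_map rad x = rad" if "x \<in> rad" for x
      using quot_eq_zero_iff[OF J, of x] that right_gr_ideal_carrier[OF J(1)] by blast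
    have "rad \<in> ?F" using F quot_zero[OF J] by (simp add: Q.additive_subgroup_iff)
    then show "rad \<subseteq> {x \<in> carrier R. quot_map rad x \<in> ?F}"
      using zero right_gr_ideal_carrier[OF J(1)] by auto
    fix T assume T: "gr_atom T"
    then have V: "quot_map rad ` T \<in> ?\<V>" by blast
    have "quot_map rad ` T \<subseteq> carrier (R Quot rad)" using sub[OF V] by (simp add: Q.additive_subgroup_iff)
    then have "quot_map rad t \<in> ?F" if "t \<in> T" for t
      using Q.family_sum_member[OF V, of "\<lambda>V. V"] that by blast
    then show "T \<subseteq> {x \<in> carrier R. quot_map rad x \<in> ?F}"
      using T right_gr_ideal_carrier by (auto simp: gr_atom_def)
  qed
  then have "carrier (R Quot rad) \<subseteq> ?F" unfolding quot_carrier[OF J] by blast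
  moreover have "?F \<subseteq> carrier (R Quot rad)" using F by (simp add: Q.additive_subgroup_iff)
  ultimately have "carrier (R Quot rad) = ?F" by blast
  then show ?thesis using simple unfolding gr_semisimple_def by blast
qed

end

theorem theorem5p10:
  fixes \<Gamma> :: "('g, 'm) groupoid_scheme"
    and R :: "('a, 'b) ring_scheme"
    and S :: "'g \<Rightarrow> 'a set"
  assumes "graded_ring \<Gamma> R S"
    and "left_\<Gamma>0_artinian \<Gamma> R S"
    and "right_\<Gamma>0_artinian \<Gamma> R S"
  shows "gr_semiprimary \<Gamma> R S \<and>
    (left_\<Gamma>0_noetherian \<Gamma> R S \<and> right_\<Gamma>0_noetherian \<Gamma> R S)"
proof -
  interpret graded_ring_struct \<Gamma> R S
    using assms(1) by (simp add: graded_ring_struct_def)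
  \<comment> \<open>Both artinian hypotheses are present, and passing to the opposite ring merely
    exchanges them.\<close>
  have "right_\<Gamma>0_noetherian (op_groupoid \<Gamma>) (op_ring R) S"
    using assms by (intro graded_ring_struct.right_noetherian[OF op_struct]) (simp_all add: chain_conditions_op)
  then have "left_\<Gamma>0_noetherian \<Gamma> R S" by (simp add: chain_conditions_op[OF assms(1)])
  then show ?thesis
    using quotient_gr_semisimple right_noetherian rad_objectwise_nilpotent assms(2,3)
    by (simp add: gr_semiprimary_def)
qed

end
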